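(* Let $\mathbb{h}\in\{\mathbb{R},\mathbb{C},\mathbb{H},\mathbb{O}\}$ be a real Hurwitz algebra and let $n\ge 2$, with $n=3$ if $\mathbb{h}=\mathbb{O}$. Equip the commutative algebra $(\mathrm{Herm}(n,\mathbb{h}),\star)$ of $n\times n$ Hermitian matrices over $\mathbb{h}$ with the invariant metric $h(x,y)=N^{-1}\operatorname{tr}L_\star(x\star y)=n^{-1}\operatorname{tr}(x\star y)$, where $N=\dim_{\mathbb{R}}\mathrm{Herm}(n,\mathbb{h})$. Then for all linearly independent $x,y\in\mathrm{Herm}(n,\mathbb{h})$ the sectional nonassociativity of $(\mathrm{Herm}(n,\mathbb{h}),\star,h)$ satisfies $$0\le \mathcal{K}(x,y)\le \tfrac{n}{2}.$$ Moreover: (1) If $\mathbb{h}$ is associative, then $\mathcal{K}(x,y)=0$ if and only if $x$ and $y$ commute with respect to the matrix product; in particular, if $x$ and $x\star x$ are linearly independent, then $\mathcal{K}(x,x\star x)=0$. (2) $\mathcal{K}(x,y)=\tfrac n2$ if and only if $x$ and $y$ are simultaneously equivalent under $\mathrm{Aut}(\mathrm{Herm}(n,\mathbb{h}),\star)$ to scalar multiples of $e_{11}-e_{nn}$ and $e_{1n}+e_{n1}$.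
   Context: $\mathbb{H}$ and $\mathbb{O}$ are the real quaternions and octonions (real Hurwitz algebras, with standard conjugation $x\mapsto\bar x$). $\mathrm{Herm}(n,\mathbb{h})=\{x\in M_n(\mathbb{h}):\bar x^{t}=x\}$, with product $x\star y=\tfrac12(xy+yx)$, where juxtaposition is the matrix product in $M_n(\mathbb{h})$. $L_\star(x)y=x\star y$, and $\operatorname{tr}L_\star$ is the trace of a real-linear endomorphism of $\mathrm{Herm}(n,\mathbb{h})$, while $\operatorname{tr}(x\star y)$ is the matrix trace (a real number, identified with an element of $\mathbb{R}\subset\mathbb{h}$). $e_{ij}$ is the matrix with $1$ in the $(i,j)$ entry and $0$ elsewhere. $\mathrm{Aut}(\mathrm{Herm}(n,\mathbb{h}),\star)$ is the group of algebra automorphisms of $(\mathrm{Herm}(n,\mathbb{h}),\star)$. A metric on an algebra $(A,\circ)$ is a nondegenerate symmetric bilinear form $h$; it is invariant if $h(x\circ y,z)=h(x,y\circ z)$ for all $x,y,z$. The sectional nonassociativity of the $h$-nondegenerate two-dimensional subspace spanned by $x,y$ is $$\mathcal{K}(x,y)=\frac{h(x\circ x,y\circ y)-h(x\circ y,y\circ x)}{h(x,x)h(y,y)-h(x,y)^2}.$$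
   Formalization: Part (2) fails for non-orthogonal x,y, e.g. e_11-e_nn and its sum with e_1n+e_n1; instead: K=n/2 iff an automorphism maps span{x,y} onto the span of e_11-e_nn, e_1n+e_n1, and (K=n/2 and h(x,y)=0) iff x,y are simultaneously equivalent to scalar multiples of these. *)

theory Defs
  imports "HOL-Analysis.Analysis"
begin

section \<open>Real algebras with involution\<close>

text \<open>Multiplication is not assumed to be associative, so the octonions are an instance.\<close>

class star_algebra = real_vector + one + times +
  fixes bar :: "'a \<Rightarrow> 'a"
  assumes star_distrib_right: "(a + b) * c = a * c + b * c"
    and star_distrib_left: "a * (b + c) = a * b + a * c"
    and star_scaleR_left: "(r *\<^sub>R a) * b = r *\<^sub>R (a * b)"
    and star_scaleR_right: "a * (r *\<^sub>R b) = r *\<^sub>R (a * b)"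
    and star_one_left: "1 * a = a"
    and star_one_right: "a * 1 = a"
    and bar_add: "bar (a + b) = bar a + bar b"
    and bar_scaleR: "bar (r *\<^sub>R a) = r *\<^sub>R bar a"
    and bar_bar: "bar (bar a) = a"
    and bar_mult: "bar (a * b) = bar b * bar a"
    and bar_one: "bar 1 = 1"

definition star_isomorphic :: "'a::star_algebra itself \<Rightarrow> 'b::star_algebra itself \<Rightarrow> bool"
  where "star_isomorphic A B \<longleftrightarrow>
    (\<exists>f :: 'a \<Rightarrow> 'b. linear f \<and> bij f \<and> f 1 = 1 \<and>
       (\<forall>a b. f (a * b) = f a * f b) \<and> (\<forall>a. f (bar a) = bar (f a)))"

instantiation real :: star_algebra
begin
definition bar_real :: "real \<Rightarrow> real" where "bar_real a = a"
instance by standard (simp_all add: bar_real_def algebra_simps)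
end

instantiation complex :: star_algebra
begin
definition bar_complex :: "complex \<Rightarrow> complex" where "bar_complex a = cnj a"
instance by standard (simp_all add: bar_complex_def algebra_simps)
end

section \<open>Quaternions and octonions\<close>

text \<open>The Cayley--Dickson double: \<open>CD a b\<close> stands for \<open>a + b l\<close> with \<open>l * l = -1\<close>.\<close>

datatype 'a cd = CD (cd_fst: 'a) (cd_snd: 'a)

instantiation cd :: (star_algebra) star_algebra
begin

definition zero_cd :: "'a cd" where "0 = CD 0 0"
definition one_cd :: "'a cd" where "1 = CD 1 0"
definition plus_cd :: "'a cd \<Rightarrow> 'a cd \<Rightarrow> 'a cd"
  where "p + q = CD (cd_fst p + cd_fst q) (cd_snd p + cd_snd q)"
definition minus_cd :: "'a cd \<Rightarrow> 'a cd \<Rightarrow> 'a cd"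
  where "p - q = CD (cd_fst p - cd_fst q) (cd_snd p - cd_snd q)"
definition uminus_cd :: "'a cd \<Rightarrow> 'a cd"
  where "- p = CD (- cd_fst p) (- cd_snd p)"
definition scaleR_cd :: "real \<Rightarrow> 'a cd \<Rightarrow> 'a cd"
  where "r *\<^sub>R p = CD (r *\<^sub>R cd_fst p) (r *\<^sub>R cd_snd p)"
definition times_cd :: "'a cd \<Rightarrow> 'a cd \<Rightarrow> 'a cd"
  where "p * q = CD (cd_fst p * cd_fst q - bar (cd_snd q) * cd_snd p)
                    (cd_snd q * cd_fst p + cd_snd p * bar (cd_fst q))"
definition bar_cd :: "'a cd \<Rightarrow> 'a cd"
  where "bar p = CD (bar (cd_fst p)) (- cd_snd p)"

instance
proof -
  have m1: "bar (- a) = - bar a" for a :: 'a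
    using bar_scaleR[of "-1" a] by simp
  have m2: "(- a) * b = - (a * b)" "a * (- b) = - (a * b)" for a b :: 'a
    using star_scaleR_left[of "-1" a b] star_scaleR_right[of a "-1" b] by simp_all
  have m3: "bar (a - b) = bar a - bar b" for a b :: 'a
    using bar_add[of a "- b"] m1 by simp
  have m4: "(0::'a) * b = 0" "b * (0::'a) = 0" "bar (0::'a) = 0" for b :: 'a
    using star_scaleR_left[of 0 b b] star_scaleR_right[of b 0 b] bar_scaleR[of 0 b] by simp_all
  show "OFCLASS('a cd, star_algebra_class)"
    by standard
      (simp_all add: zero_cd_def one_cd_def plus_cd_def minus_cd_def uminus_cd_def
        scaleR_cd_def times_cd_def bar_cd_def m1 m2 m3 m4 bar_add bar_scaleR bar_bar bar_mult
        bar_one star_distrib_left star_distrib_right star_scaleR_left star_scaleR_right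
        star_one_left star_one_right scaleR_add_right scaleR_add_left scaleR_diff_right)
qed

end

type_synonym quat = "complex cd"
type_synonym octo = "quat cd"

section \<open>Metrics on algebras\<close>

text \<open>
  An algebra is given by a subspace \<open>V\<close> of a real vector space and a multiplication \<open>m\<close>,
  of which only the values on \<open>V\<close> matter.
\<close>

definition lin_on :: "'v::real_vector set \<Rightarrow> ('v \<Rightarrow> 'w::real_vector) \<Rightarrow> bool"
  where "lin_on V f \<longleftrightarrow> (\<forall>x\<in>V. \<forall>y\<in>V. f (x + y) = f x + f y) \<and>
                        (\<forall>r. \<forall>x\<in>V. f (r *\<^sub>R x) = r *\<^sub>R f x)"

definition invariant_metric ::
    "'v::real_vector set \<Rightarrow> ('v \<Rightarrow> 'v \<Rightarrow> 'v) \<Rightarrow> ('v \<Rightarrow> 'v \<Rightarrow> real) \<Rightarrow> bool"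
  where "invariant_metric V m h \<longleftrightarrow>
     (\<forall>x\<in>V. lin_on V (h x)) \<and> (\<forall>y\<in>V. lin_on V (\<lambda>x. h x y)) \<and>
     (\<forall>x\<in>V. \<forall>y\<in>V. h x y = h y x) \<and>
     (\<forall>x\<in>V. (\<forall>y\<in>V. h x y = 0) \<longrightarrow> x = 0) \<and>
     (\<forall>x\<in>V. \<forall>y\<in>V. \<forall>z\<in>V. h (m x y) z = h x (m y z))"

definition alg_aut :: "'v::real_vector set \<Rightarrow> ('v \<Rightarrow> 'v \<Rightarrow> 'v) \<Rightarrow> ('v \<Rightarrow> 'v) set"
  where "alg_aut V m = {\<phi>. bij_betw \<phi> V V \<and> lin_on V \<phi> \<and>
                           (\<forall>x\<in>V. \<forall>y\<in>V. \<phi> (m x y) = m (\<phi> x) (\<phi> y))}"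

definition sectional_nonassoc ::
    "('v \<Rightarrow> 'v \<Rightarrow> 'v) \<Rightarrow> ('v \<Rightarrow> 'v \<Rightarrow> real) \<Rightarrow> 'v \<Rightarrow> 'v \<Rightarrow> real"
  where "sectional_nonassoc m h x y =
     (h (m x x) (m y y) - h (m x y) (m y x)) / (h x x * h y y - (h x y)\<^sup>2)"

text \<open>The trace of an endomorphism of a finite-dimensional \<open>V\<close>; any basis gives the same value.\<close>

definition endo_trace :: "'v::real_vector set \<Rightarrow> ('v \<Rightarrow> 'v) \<Rightarrow> real"
  where "endo_trace V f =
     (let B = (SOME B. independent B \<and> span B = V) in \<Sum>b\<in>B. representation B (f b) b)"

section \<open>Hermitian matrices\<close>

text \<open>The matrix product \<open>**\<close> and \<open>trace\<close> of the library require associative entries.\<close>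

definition mat_prod :: "'a::star_algebra^'n^'n \<Rightarrow> 'a^'n^'n \<Rightarrow> 'a^'n^'n"
  where "mat_prod x y = (\<chi> i j. \<Sum>k\<in>UNIV. x $ i $ k * y $ k $ j)"

definition mat_trace :: "'a::star_algebra^'n^'n \<Rightarrow> 'a"
  where "mat_trace x = (\<Sum>i\<in>UNIV. x $ i $ i)"

definition mat_unit :: "'n \<Rightarrow> 'n \<Rightarrow> 'a::star_algebra^'n^'n"
  where "mat_unit i j = (\<chi> k l. if k = i \<and> l = j then 1 else 0)"

definition Herm :: "('a::star_algebra^'n^'n) set"
  where "Herm = {x. \<forall>i j. bar (x $ j $ i) = x $ i $ j}"

definition jordan :: "'a::star_algebra^'n^'n \<Rightarrow> 'a^'n^'n \<Rightarrow> 'a^'n^'n"  (infixl \<open>\<star>\<close> 70)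
  where "x \<star> y = (1 / 2) *\<^sub>R (mat_prod x y + mat_prod y x)"

definition herm_metric :: "'a::star_algebra^'n^'n \<Rightarrow> 'a^'n^'n \<Rightarrow> real"
  where "herm_metric x y =
     endo_trace Herm (\<lambda>z. (x \<star> y) \<star> z) / real (dim (Herm :: ('a^'n^'n) set))"

abbreviation herm_K :: "'a::star_algebra^'n^'n \<Rightarrow> 'a^'n^'n \<Rightarrow> real"
  where "herm_K \<equiv> sectional_nonassoc (\<star>) herm_metric"

end

theory Submission
  imports Defs
begin

text \<open>
  The metric is \<open>h x y = (1/n) Re tr (x y)\<close>. The reason is that \<open>z \<mapsto> tr L(z)\<close> is a linear functional
  invariant under automorphisms: sign changes of coordinates make it vanish on off-diagonal
  matrices, permuting coordinates makes its values on the diagonal units equal, and the identity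
  matrix fixes the remaining constant (\<open>endo_trace_jordan\<close>). The same invariance shows that every automorphism
  is an isometry of the positive definite form \<open>h\<close>.

  Therefore the automorphism group is compact, and among the images of a given \<open>x\<close> there is one with
  the largest sum of squares of diagonal entries (\<open>aut_orbit_maximiser\<close>). This image is diagonal:
  a nonzero entry \<open>(i, j)\<close> could be made real by a phase automorphism, after which one step of
  Jacobi's eigenvalue method, a reflection in the plane of the coordinates \<open>i, j\<close>, would enlarge
  the sum (\<open>jacobi_step\<close>, \<open>diagonalise\<close>). This argument is the same for all four algebras. The
  octonions need special care only for the phase automorphisms: conjugation by
  \<open>diag (bar a, 1, a)\<close> with a unit \<open>a\<close> is an automorphism for \<open>n = 3\<close>, because of the three
  Moufang identities (\<open>moufang_unit\<close>, \<open>diag_conj_aut\<close>).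

  If \<open>x = diag (a)\<close>, then \<open>x \<star> y\<close> has the entries \<open>(a i + a j) / 2 * y i j\<close>. So the numerator of
  \<open>K\<close> is \<open>(1 / 4n) \<Sum> (a i - a j)\<^sup>2 |y i j|\<^sup>2\<close>, which is nonnegative, and \<open>n\<^sup>2\<close> times the denominator is
  \<open>|a|\<^sup>2 \<Sum> |y i j|\<^sup>2 - (\<Sum> a i * y i i)\<^sup>2\<close>. The upper bound combines \<open>(a i - a j)\<^sup>2 \<le> 2 |a|\<^sup>2\<close> for the
  off-diagonal entries of \<open>y\<close> with the Cauchy--Schwarz inequality for its diagonal. Equality forces
  \<open>a\<close> to be a multiple of \<open>e i - e j\<close> and \<open>y\<close> to be a multiple of \<open>x\<close> plus a matrix supported at
  \<open>(i, j)\<close> and \<open>(j, i)\<close>; a permutation and a phase automorphism take such a pair to the model plane.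
  Over an associative algebra the numerator is \<open>1 / 4n\<close> times the squared norm of the commutator
  (\<open>commutator_norm\<close>), which gives the case of \<open>K = 0\<close>.
\<close>

section \<open>Alternative algebras with a positive norm\<close>

lemma linear_star_left: "linear (\<lambda>a::'a::star_algebra. a * b)"
  by (rule linearI) (simp_all add: star_distrib_right star_scaleR_left)

lemma linear_star_right: "linear (\<lambda>b::'a::star_algebra. a * b)"
  by (rule linearI) (simp_all add: star_distrib_left star_scaleR_right)

lemma linear_bar: "linear (bar :: 'a::star_algebra \<Rightarrow> 'a)"
  by (rule linearI) (simp_all add: bar_add bar_scaleR)

lemmas star_sum_left = linear_sum[OF linear_star_left]
  and star_sum_right = linear_sum[OF linear_star_right]
  and bar_sum = linear_sum[OF linear_bar]

lemmas star_linear [simp] =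
  linear_0[OF linear_star_left] linear_0[OF linear_star_right] linear_0[OF linear_bar]
  linear_neg[OF linear_star_left] linear_neg[OF linear_star_right] linear_neg[OF linear_bar]
  linear_diff[OF linear_star_left] linear_diff[OF linear_star_right] linear_diff[OF linear_bar]
  star_distrib_left star_distrib_right star_scaleR_left star_scaleR_right
  star_one_left star_one_right bar_add bar_scaleR bar_bar bar_mult bar_one

text \<open>
  The real part. It is meaningful when every \<open>a + bar a\<close> is a multiple of \<open>1\<close>.
\<close>

definition re :: "'a::star_algebra \<Rightarrow> real"
  where "re a = (SOME r. a + bar a = (2 * r) *\<^sub>R 1)"

definition nrm :: "'a::star_algebra \<Rightarrow> real"
  where "nrm a = re (bar a * a)"

text \<open>
  Five properties that the four algebras share and from which everything below is derived. They are
  stable under Cayley--Dickson doubling of an associative algebra and under isomorphism.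
\<close>

locale hurwitz =
  fixes type :: "'a::star_algebra itself"
  assumes one_neq_zero: "(1::'a) \<noteq> 0"
    and self_conjugate: "bar a = a \<Longrightarrow> \<exists>r. (a::'a) = r *\<^sub>R 1"
    and left_alternative: "(a::'a) * (a * b) = (a * a) * b"
    and norm_positive: "(a::'a) \<noteq> 0 \<Longrightarrow> \<exists>r>0. bar a * a = r *\<^sub>R 1"
    and finite_dimensional: "\<exists>F. finite F \<and> span F = (UNIV :: 'a set)"
begin

lemma one_neq_zero' [simp]: "(1::'a) \<noteq> 0" "0 \<noteq> (1::'a)"
  using one_neq_zero by auto

lemma scalar_eq_iff [simp]: "r *\<^sub>R (1::'a) = s *\<^sub>R 1 \<longleftrightarrow> r = s"
  using one_neq_zero by simp

lemma re_eqI: "(a::'a) + bar a = (2 * r) *\<^sub>R 1 \<Longrightarrow> re a = r"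
  unfolding re_def by (rule some_equality) auto

lemma add_bar: "(a::'a) + bar a = (2 * re a) *\<^sub>R 1"
proof -
  have "bar (a + bar a) = a + bar a"
    by (simp add: add.commute)
  then obtain r where "a + bar a = r *\<^sub>R 1"
    using self_conjugate by blast
  then show ?thesis
    using re_eqI[of a "r / 2"] by simp
qed

lemma bar_eq: "bar (a::'a) = (2 * re a) *\<^sub>R 1 - a"
  using add_bar[of a] by (simp add: eq_diff_eq add.commute)

lemma re_add [simp]: "re ((a::'a) + b) = re a + re b"
proof (rule re_eqI)
  have "a + b + bar (a + b) = (a + bar a) + (b + bar b)" by simp
  then show "a + b + bar (a + b) = (2 * (re a + re b)) *\<^sub>R 1"
    by (simp only: add_bar) (simp add: scaleR_add_left distrib_left)
qed

lemma re_scaleR [simp]: "re (r *\<^sub>R (a::'a)) = r * re a"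
proof (rule re_eqI)
  have "r *\<^sub>R a + bar (r *\<^sub>R a) = r *\<^sub>R (a + bar a)" by (simp add: scaleR_add_right)
  then show "r *\<^sub>R a + bar (r *\<^sub>R a) = (2 * (r * re a)) *\<^sub>R 1"
    by (simp only: add_bar) simp
qed

lemma linear_re: "linear (re :: 'a \<Rightarrow> real)"
  by (rule linearI) auto

lemma re_simps [simp]:
  "re (0::'a) = 0" "re (- (a::'a)) = - re a" "re (a - b) = re a - re b" "re (bar a) = re a"
  "re (1::'a) = 1"
proof -
  show "re (bar a) = re a"
    by (rule re_eqI) (use add_bar[of a] in \<open>simp add: add.commute\<close>)
  show "re (1::'a) = 1"
    by (rule re_eqI) (simp flip: scaleR_2)
qed (simp_all add: linear_0[OF linear_re] linear_neg[OF linear_re] linear_diff[OF linear_re])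

lemmas re_sum = linear_sum[OF linear_re]

lemma self_conjugate_eq: "bar (a::'a) = a \<Longrightarrow> a = re a *\<^sub>R 1"
  using self_conjugate[of a] by auto

lemma bar_mult_self: "bar a * a = nrm a *\<^sub>R (1::'a)"
  unfolding nrm_def by (rule self_conjugate_eq) simp

lemma mult_bar_self: "a * bar a = nrm a *\<^sub>R (1::'a)"
proof -
  have "a * bar a = bar a * a" by (simp add: bar_eq[of a])
  then show ?thesis by (simp add: bar_mult_self)
qed

lemma nrm_simps [simp]: "nrm (0::'a) = 0" "nrm (bar (a::'a)) = nrm a" "nrm (1::'a) = 1"
  by (simp_all add: nrm_def[of "bar a"] mult_bar_self) (simp_all add: nrm_def)

lemma nrm_pos: "(a::'a) \<noteq> 0 \<Longrightarrow> nrm a > 0"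
  using norm_positive[of a] by (auto simp: bar_mult_self)

lemma nrm_eq_0_iff [simp]: "nrm (a::'a) = 0 \<longleftrightarrow> a = 0"
  using nrm_pos[of a] by (metis less_irrefl nrm_simps(1))

lemma nrm_nonneg [simp]: "0 \<le> nrm (a::'a)"
  using nrm_pos[of a] by (cases "a = 0") auto

lemma nrm_scaleR [simp]: "nrm (r *\<^sub>R (a::'a)) = r\<^sup>2 * nrm a"
  by (simp add: nrm_def power2_eq_square)

lemma right_alternative: "((b::'a) * a) * a = b * (a * a)"
proof -
  have "bar (bar a * (bar a * bar b)) = bar ((bar a * bar a) * bar b)"
    by (simp add: left_alternative)
  then show ?thesis by simp
qed

lemma cancel_left: "bar a * (a * b) = nrm a *\<^sub>R (b::'a)"
proof -
  have "bar a * (a * b) = (bar a * a) * b"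
    by (simp add: bar_eq[of a] left_alternative)
  then show ?thesis by (simp add: bar_mult_self)
qed

lemma cancel_left': "a * (bar a * b) = nrm a *\<^sub>R (b::'a)"
  using cancel_left[of "bar a" b] by simp

lemma cancel_right: "(b * a) * bar a = nrm a *\<^sub>R (b::'a)"
proof -
  have "bar (a * (bar a * bar b)) = bar (nrm a *\<^sub>R bar b)"
    by (simp only: cancel_left')
  then show ?thesis by simp
qed

lemma cancel_right': "(b * bar a) * a = nrm a *\<^sub>R (b::'a)"
  using cancel_right[of b "bar a"] by simp

text \<open>
  The associator is alternating; this carries the identities of Moufang and the associativity
  of the real part.
\<close>

definition associator :: "'a \<Rightarrow> 'a \<Rightarrow> 'a \<Rightarrow> 'a"
  where "associator a b c = (a * b) * c - a * (b * c)"

lemma associator_swap_left: "associator b a c = - associator a b c"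
proof -
  have "(a + b) * ((a + b) * c) = ((a + b) * (a + b)) * c"
    by (rule left_alternative)
  then have "a * (b * c) + b * (a * c) = (a * b) * c + (b * a) * c"
    by (simp add: left_alternative algebra_simps)
  then show ?thesis by (simp add: associator_def algebra_simps)
qed

lemma associator_swap_right: "associator a c b = - associator a b c"
proof -
  have "(a * (b + c)) * (b + c) = a * ((b + c) * (b + c))"
    by (rule right_alternative)
  then have "(a * b) * c + (a * c) * b = a * (b * c) + a * (c * b)"
    by (simp add: right_alternative algebra_simps)
  then show ?thesis by (simp add: associator_def algebra_simps)
qed

lemma flexible: "((a::'a) * b) * a = a * (b * a)"
proof -
  have "associator a b a = - associator a a b" by (rule associator_swap_right)
  also have "\<dots> = 0" by (simp add: associator_def left_alternative)
  finally show ?thesis by (simp add: associator_def)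
qed

text \<open>
  After both sides are expressed through associators, what has to vanish is
  \<open>(a, a x, y) + (a, a y, x)\<close>. This is symmetric in \<open>x\<close> and \<open>y\<close>, and left alternativity turns it into
  associators that are antisymmetric in \<open>x\<close> and \<open>y\<close>.
\<close>

lemma moufang_left: "((a * x) * a) * y = a * (x * (a * (y::'a)))"
proof -
  have 1: "((a * x) * a) * y - a * (x * (a * y)) = associator (a * x) a y + associator a x (a * y)"
    by (simp add: associator_def)
  have 2: "associator (a * x) a y = - associator a (a * x) y"
    by (rule associator_swap_left)
  have 3: "associator a x (a * y) = - associator a (a * y) x"
    by (rule associator_swap_right)
  have "associator a (a * x) y + associator a (a * y) x =
      associator (a * a) x y + associator (a * a) y x - a * (associator a x y + associator a y x)"
    by (simp add: associator_def left_alternative)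
  also have "\<dots> = 0"
    by (simp add: associator_swap_right[of _ y x])
  finally have "associator (a * x) a y + associator a x (a * y) = 0"
    unfolding 2 3 by (metis add.inverse_distrib_swap add.commute neg_equal_0_iff_equal)
  then show ?thesis
    using 1 by simp
qed

lemma moufang_right: "y * ((a * x) * a) = ((y * a) * x) * (a::'a)"
proof -
  have "bar (((bar a * bar x) * bar a) * bar y) = bar (bar a * (bar x * (bar a * bar y)))"
    by (simp only: moufang_left)
  then show ?thesis by (simp add: flexible)
qed

lemma moufang_middle: "(a * x) * (y * a) = (a * (x * y)) * (a::'a)"
proof -
  have 1: "(a * x) * (y * a) - (a * (x * y)) * a = associator a x (y * a) - a * associator x y a"
    by (simp add: associator_def flexible)
  have "associator a x (y * a) = - associator a (y * a) x"
    by (rule associator_swap_right)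
  also have "\<dots> = a * ((y * a) * x) - ((a * y) * a) * x"
    by (simp add: associator_def flexible)
  also have "\<dots> = a * associator y a x"
    by (simp add: moufang_left associator_def)
  also have "associator y a x = associator x y a"
    by (metis associator_swap_left associator_swap_right)
  finally show ?thesis using 1 by simp
qed

lemma re_mult_commute: "re ((a::'a) * b) = re (b * a)"
proof -
  have "re (a * b) = re (bar b * bar a)"
    by (metis bar_mult re_simps(4))
  also have "\<dots> = re (b * a)"
    by (simp add: bar_eq[of a] bar_eq[of b])
  finally show ?thesis .
qed

text \<open>
  Conjugation reverses the arguments of an associator and changes its sign three times, while reversing
  three arguments is an odd permutation. So an associator is purely imaginary.
\<close>

lemma re_mult_assoc: "re (((a::'a) * b) * c) = re (a * (b * c))"
proof -
  have "bar (associator a b c) = - associator (bar c) (bar b) (bar a)"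
    by (simp add: associator_def)
  also have "\<dots> = associator c b a"
    by (simp add: associator_def bar_eq[of a] bar_eq[of b] bar_eq[of c])
  also have "\<dots> = - associator a b c"
    by (metis associator_swap_left associator_swap_right)
  finally have "re (associator a b c) = 0"
    by (metis re_simps(2,4) add.inverse_inverse equal_neg_zero)
  then show ?thesis by (simp add: associator_def)
qed

lemma re_mult_isometry_left: "re ((c * a) * bar (c * b)) = nrm c * re ((a::'a) * bar b)"
proof -
  have "re ((c * a) * bar (c * b)) = re ((bar b * bar c) * (c * a))"
    by (simp add: re_mult_commute)
  also have "\<dots> = re (bar b * (bar c * (c * a)))"
    by (rule re_mult_assoc)
  also have "\<dots> = nrm c * re (a * bar b)"
    by (simp add: cancel_left re_mult_commute)
  finally show ?thesis .
qed

lemma re_mult_isometry_right: "re ((a * c) * bar (b * c)) = nrm c * re ((a::'a) * bar b)"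
proof -
  have "re ((a * c) * bar (b * c)) = re (a * (c * (bar c * bar b)))"
    by (simp add: re_mult_assoc)
  then show ?thesis by (simp add: cancel_left')
qed

lemma re_mult_self: "re ((a::'a) * bar a) = nrm a"
  by (simp add: mult_bar_self)

end

section \<open>The four Hurwitz algebras by Cayley--Dickson doubling\<close>

lemma cd_simps [simp]:
  "cd_fst (0::'a::star_algebra cd) = 0" "cd_snd (0::'a cd) = 0"
  "cd_fst (1::'a cd) = 1" "cd_snd (1::'a cd) = 0"
  "cd_fst (p + q) = cd_fst p + cd_fst (q::'a cd)" "cd_snd (p + q) = cd_snd p + cd_snd (q::'a cd)"
  "cd_fst (p - q) = cd_fst p - cd_fst (q::'a cd)" "cd_snd (p - q) = cd_snd p - cd_snd (q::'a cd)"
  "cd_fst (- q) = - cd_fst (q::'a cd)" "cd_snd (- q) = - cd_snd (q::'a cd)"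
  "cd_fst (r *\<^sub>R q) = r *\<^sub>R cd_fst (q::'a cd)" "cd_snd (r *\<^sub>R q) = r *\<^sub>R cd_snd (q::'a cd)"
  "cd_fst (bar q) = bar (cd_fst (q::'a cd))" "cd_snd (bar q) = - cd_snd (q::'a cd)"
  "cd_fst (p * q) = cd_fst p * cd_fst q - bar (cd_snd q) * cd_snd (p::'a cd)"
  "cd_snd (p * q) = cd_snd q * cd_fst p + cd_snd p * bar (cd_fst (q::'a cd))"
  by (simp_all add: zero_cd_def one_cd_def plus_cd_def minus_cd_def uminus_cd_def scaleR_cd_def
      times_cd_def bar_cd_def)

lemma span_UNIV_cd:
  assumes "span F = (UNIV :: 'a::star_algebra set)"
  shows "span ((\<lambda>a. CD a 0) ` F \<union> CD 0 ` F) = (UNIV :: 'a cd set)"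
proof -
  let ?G = "(\<lambda>a. CD a 0) ` F \<union> CD 0 ` F"
  have lin: "linear (\<lambda>a::'a. CD a 0)" "linear (CD (0::'a))"
    by (rule linearI; simp add: cd.expand)+
  have "CD a 0 \<in> span ?G" for a
  proof -
    have "CD a 0 \<in> (\<lambda>a. CD a 0) ` span F" using assms by blast
    also have "\<dots> \<subseteq> span ?G"
      unfolding linear_span_image[OF lin(1), symmetric] by (rule span_mono) blast
    finally show ?thesis .
  qed
  moreover have "CD 0 a \<in> span ?G" for a
  proof -
    have "CD 0 a \<in> CD 0 ` span F" using assms by blast
    also have "\<dots> \<subseteq> span ?G"
      unfolding linear_span_image[OF lin(2), symmetric] by (rule span_mono) blast
    finally show ?thesis .
  qed
  moreover have "p = CD (cd_fst p) 0 + CD 0 (cd_snd p)" for p :: "'a cd"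
    by (simp add: cd.expand)
  ultimately show ?thesis
    by (metis UNIV_eq_I span_add)
qed

text \<open>
  Associativity is what makes the double alternative: the terms that have to match contain a norm or
  a trace \<open>a + bar a\<close>, and these are scalars.
\<close>

lemma hurwitz_cd:
  assumes "hurwitz TYPE('a::star_algebra)"
    and assoc: "\<And>a b c :: 'a. (a * b) * c = a * (b * c)"
  shows "hurwitz TYPE('a cd)"
proof -
  interpret hurwitz "TYPE('a)" by fact
  have norm_cd: "bar p * p = (nrm (cd_fst p) + nrm (cd_snd p)) *\<^sub>R 1" for p :: "'a cd"
    by (rule cd.expand) (simp add: bar_mult_self scaleR_add_left)
  show ?thesis
  proof
    show "(1::'a cd) \<noteq> 0" by (metis cd_simps(1,3) one_neq_zero)
    show "\<exists>r. p = r *\<^sub>R 1" if "bar p = p" for p :: "'a cd"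
    proof -
      have "bar (cd_fst p) = cd_fst p" "- cd_snd p = cd_snd p"
        using that by (metis cd_simps(13), metis cd_simps(14))
      moreover from this(2) have "2 *\<^sub>R cd_snd p = 0"
        unfolding scaleR_2 by (metis add.left_inverse)
      ultimately have "p = re (cd_fst p) *\<^sub>R 1"
        using self_conjugate_eq[of "cd_fst p"] by (intro cd.expand) simp
      then show ?thesis ..
    qed
    show "\<exists>r>0. bar p * p = r *\<^sub>R 1" if "p \<noteq> 0" for p :: "'a cd"
    proof -
      have "cd_fst p \<noteq> 0 \<or> cd_snd p \<noteq> 0"
        using that by (metis cd.expand cd_simps(1,2))
      then have "0 < nrm (cd_fst p) + nrm (cd_snd p)"
        by (metis add_nonneg_pos add_pos_nonneg nrm_nonneg nrm_pos)
      then show ?thesis using norm_cd by blast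
    qed
    show "p * (p * q) = (p * p) * q" for p q :: "'a cd"
    proof -
      define a b c d where "a = cd_fst p" "b = cd_snd p" "c = cd_fst q" "d = cd_snd q"
      have 1: "a * (a * c - bar d * b) - bar (d * a + b * bar c) * b
          = (a * a - bar b * b) * c - bar d * (b * a + b * bar a)"
        using arg_cong[OF bar_mult_self[of b], of "\<lambda>s. s * c"]
        by (simp add: assoc bar_eq[of a] bar_mult_self)
      have 2: "(d * a + b * bar c) * a + b * bar (a * c - bar d * b)
          = d * (a * a - bar b * b) + (b * a + b * bar a) * bar c"
        using arg_cong[OF mult_bar_self[of b], of "\<lambda>s. s * d"]
        by (simp add: assoc bar_eq[of a] bar_mult_self)
      show ?thesis
        by (rule cd.expand) (use 1 2 in \<open>simp add: a_b_c_d_def\<close>)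
    qed
    obtain F where "finite F" "span F = (UNIV :: 'a set)"
      using finite_dimensional by blast
    then show "\<exists>F. finite F \<and> span F = (UNIV :: 'a cd set)"
      by (intro exI[of _ "(\<lambda>a. CD a 0) ` F \<union> CD 0 ` F"]) (simp add: span_UNIV_cd)
  qed
qed

lemma hurwitz_real: "hurwitz TYPE(real)"
proof
  show "\<exists>r>0. bar a * a = r *\<^sub>R 1" if "a \<noteq> 0" for a :: real
    using that by (intro exI[of _ "a * a"]) (simp add: bar_real_def zero_less_mult_iff neq_iff disj_commute)
  have "finite (Basis :: real set)" "span (Basis :: real set) = UNIV"
    by (rule finite_Basis, rule span_Basis)
  then show "\<exists>F. finite F \<and> span F = (UNIV :: real set)" by blast
qed simp_all

lemma hurwitz_complex: "hurwitz TYPE(complex)"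
proof
  show "\<exists>r. a = r *\<^sub>R 1" if "bar a = a" for a :: complex
    using that by (intro exI[of _ "Re a"]) (simp add: bar_complex_def complex_eq_iff)
  show "\<exists>r>0. bar a * a = r *\<^sub>R 1" if "a \<noteq> 0" for a :: complex
    using that
    by (intro exI[of _ "(Re a)\<^sup>2 + (Im a)\<^sup>2"])
      (auto simp: bar_complex_def complex_eq_iff sum_power2_gt_zero_iff simp flip: power2_eq_square)
  have "finite (Basis :: complex set)" "span (Basis :: complex set) = UNIV" by simp_all
  then show "\<exists>F. finite F \<and> span F = (UNIV :: complex set)" by blast
qed simp_all

lemma quat_assoc: "((p::quat) * q) * r = p * (q * r)"
  by (rule cd.expand) (simp add: bar_complex_def algebra_simps)

lemma hurwitz_quat: "hurwitz TYPE(quat)"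
  using hurwitz_cd[OF hurwitz_complex] by (simp add: mult.assoc)

lemma hurwitz_octo: "hurwitz TYPE(octo)"
  using hurwitz_cd[OF hurwitz_quat] by (simp add: quat_assoc)

lemma hurwitz_star_isomorphic:
  assumes "star_isomorphic TYPE('a::star_algebra) TYPE('b::star_algebra)" "hurwitz TYPE('b)"
  shows "hurwitz TYPE('a)"
proof -
  interpret B: hurwitz "TYPE('b)" by fact
  obtain f :: "'a \<Rightarrow> 'b" where f: "linear f" "bij f" "f 1 = 1"
    "\<And>a b. f (a * b) = f a * f b" "\<And>a. f (bar a) = bar (f a)"
    using assms(1) unfolding star_isomorphic_def by blast
  have inj: "a = b" if "f a = f b" for a b
    using that f(2) by (simp add: bij_def inj_eq)
  have f': "f (r *\<^sub>R a) = r *\<^sub>R f a" "f 0 = 0" for r a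
    using f(1) by (simp_all add: linear_scale linear_0)
  show ?thesis
  proof
    show "(1::'a) \<noteq> 0" using f(3) f'(2) B.one_neq_zero by metis
    show "\<exists>r. a = r *\<^sub>R 1" if "bar a = a" for a :: 'a
      using B.self_conjugate[of "f a"] that inj f f' by metis
    show "a * (a * b) = (a * a) * b" for a b :: 'a
      by (rule inj) (simp add: f B.left_alternative)
    show "\<exists>r>0. bar a * a = r *\<^sub>R 1" if "a \<noteq> 0" for a :: 'a
      using B.norm_positive[of "f a"] that inj f f' by metis
    obtain F where F: "finite F" "span F = (UNIV :: 'b set)"
      using B.finite_dimensional by blast
    have "f ` span (inv f ` F) = UNIV"
      using f(1,2) F(2)
      by (simp add: linear_span_image[symmetric] image_image bij_is_surj surj_f_inv_f)
    then have "span (inv f ` F) = UNIV"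
      using f(2) by (metis bij_is_inj inj_image_eq_iff bij_is_surj)
    then show "\<exists>F. finite F \<and> span F = (UNIV :: 'a set)"
      using F(1) by blast
  qed
qed

lemma assoc_star_isomorphic:
  assumes "star_isomorphic TYPE('a::star_algebra) TYPE('b::star_algebra)"
    and "\<And>a b c :: 'b. (a * b) * c = a * (b * c)"
  shows "((a::'a) * b) * c = a * (b * c)"
proof -
  obtain f :: "'a \<Rightarrow> 'b" where f: "bij f" "\<And>a b. f (a * b) = f a * f b"
    using assms(1) unfolding star_isomorphic_def by blast
  have "f ((a * b) * c) = f (a * (b * c))" by (simp add: f(2) assms(2))
  then show ?thesis using f(1) by (simp add: bij_def inj_eq)
qed

section \<open>Traces, and compactness of the automorphism group\<close>

lemma lin_on_sum:
  assumes "subspace V" "lin_on V f" "finite A" "\<And>a. a \<in> A \<Longrightarrow> g a \<in> V"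
  shows "f (\<Sum>a\<in>A. r a *\<^sub>R g a) = (\<Sum>a\<in>A. r a *\<^sub>R f (g a))"
  using assms(3,4)
proof (induction A rule: finite_induct)
  case empty
  have "f (0 *\<^sub>R 0) = 0 *\<^sub>R f 0"
    using assms(1,2) unfolding lin_on_def by (metis subspace_0)
  then show ?case by simp
next
  case (insert a A)
  have "(\<Sum>a\<in>A. r a *\<^sub>R g a) \<in> V"
    using insert.prems assms(1) by (intro subspace_sum subspace_scale) auto
  moreover have "g a \<in> V" "r a *\<^sub>R g a \<in> V"
    using insert.prems assms(1) by (auto intro: subspace_scale)
  ultimately show ?case
    using insert assms(2) by (simp add: lin_on_def)
qed

lemma linear_imp_lin_on: "linear f \<Longrightarrow> lin_on V f"
  by (simp add: lin_on_def linear_add linear_scale)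

lemma lin_on_compose:
  assumes "lin_on V f" "\<And>x. x \<in> V \<Longrightarrow> f x \<in> W" "lin_on W g"
  shows "lin_on V (\<lambda>x. g (f x))"
  using assms by (simp add: lin_on_def)

lemma lin_on_inv_into:
  assumes V: "subspace V" and bij: "bij_betw \<phi> V V" and lin: "lin_on V \<phi>"
  shows "lin_on V (inv_into V \<phi>)"
proof -
  let ?\<psi> = "inv_into V \<phi>"
  have \<psi>: "?\<psi> x \<in> V" "\<phi> (?\<psi> x) = x" if "x \<in> V" for x
    using that bij by (auto simp: bij_betw_def intro: inv_into_into f_inv_into_f)
  have eq: "?\<psi> x = y" if "y \<in> V" "\<phi> y = x" for x y
    using that bij by (auto simp: bij_betw_def)
  show ?thesis
    unfolding lin_on_def using V lin
    by (auto intro!: eq simp: \<psi> subspace_add subspace_scale lin_on_def)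
qed

locale finite_dimensional_subspace =
  fixes V :: "'v::real_vector set"
  assumes V: "subspace V" and finite_span: "\<exists>F. finite F \<and> V \<subseteq> span F"
begin

definition basis :: "'v set"
  where "basis = (SOME B. independent B \<and> span B = V)"

lemma independent_basis: "independent basis" and span_basis: "span basis = V"
proof -
  obtain B where "B \<subseteq> V" "independent B" "V \<subseteq> span B"
    using maximal_independent_subset by blast
  then have "\<exists>B. independent B \<and> span B = V"
    using V by (metis span_minimal subset_antisym)
  then show "independent basis" "span basis = V"
    unfolding basis_def by (metis (mono_tags, lifting) someI_ex)+
qed

lemma finite_basis: "finite basis"
  using finite_span independent_span_bound[OF _ independent_basis] span_basis span_superset
  by (metis subset_trans)

lemma basis_in: "b \<in> basis \<Longrightarrow> b \<in> V"
  using span_basis span_base by blast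

lemma lin_on_representation: "lin_on V (\<lambda>v. representation basis v b)"
  by (simp add: lin_on_def span_basis representation_add representation_scale independent_basis)

lemma basis_expansion: "v \<in> V \<Longrightarrow> v = (\<Sum>b\<in>basis. representation basis v b *\<^sub>R b)"
  using sum_representation_eq[OF independent_basis _ finite_basis subset_refl] span_basis by simp

lemma endo_trace_basis: "endo_trace V f = (\<Sum>b\<in>basis. representation basis (f b) b)"
  by (simp add: endo_trace_def basis_def Let_def)

text \<open>
  A trace may be computed from any finite spanning family with coordinate functionals, even if the
  family is redundant. An automorphism carries such a family to another one, which makes the trace
  invariant under conjugation.
\<close>

lemma endo_trace_dual_system:
  assumes I: "finite I" "\<And>i. i \<in> I \<Longrightarrow> e i \<in> V" "\<And>i. i \<in> I \<Longrightarrow> lin_on V (c i)"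
    and expand: "\<And>x. x \<in> V \<Longrightarrow> x = (\<Sum>i\<in>I. c i x *\<^sub>R e i)"
    and f: "lin_on V f" "\<And>x. x \<in> V \<Longrightarrow> f x \<in> V"
  shows "endo_trace V f = (\<Sum>i\<in>I. c i (f (e i)))"
proof -
  let ?r = "representation basis"
  have 1: "?r (f b) b = (\<Sum>i\<in>I. c i b * ?r (f (e i)) b)" if "b \<in> basis" for b
  proof -
    have "lin_on V (\<lambda>x. ?r (f x) b)"
      by (rule lin_on_compose[OF f lin_on_representation])
    then have "?r (f (\<Sum>i\<in>I. c i b *\<^sub>R e i)) b = (\<Sum>i\<in>I. c i b *\<^sub>R ?r (f (e i)) b)"
      by (rule lin_on_sum[OF V _ I(1,2)])
    then show ?thesis
      using expand[OF basis_in[OF that]] by simp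
  qed
  have 2: "c i (f (e i)) = (\<Sum>b\<in>basis. ?r (f (e i)) b * c i b)" if "i \<in> I" for i
  proof -
    have "c i (\<Sum>b\<in>basis. ?r (f (e i)) b *\<^sub>R b) = (\<Sum>b\<in>basis. ?r (f (e i)) b *\<^sub>R c i b)"
      by (rule lin_on_sum[OF V I(3)[OF that] finite_basis basis_in])
    then show ?thesis
      using basis_expansion[OF f(2)[OF I(2)[OF that]]] by simp
  qed
  have "endo_trace V f = (\<Sum>b\<in>basis. \<Sum>i\<in>I. c i b * ?r (f (e i)) b)"
    by (simp add: endo_trace_basis 1)
  also have "\<dots> = (\<Sum>i\<in>I. \<Sum>b\<in>basis. ?r (f (e i)) b * c i b)"
    by (subst sum.swap) (simp add: mult.commute)
  finally show ?thesis by (simp add: 2)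
qed

lemma endo_trace_conjugate:
  assumes \<phi>: "bij_betw \<phi> V V" "lin_on V \<phi>"
    and f: "\<And>x. x \<in> V \<Longrightarrow> f x \<in> V"
    and g: "lin_on V g" "\<And>x. x \<in> V \<Longrightarrow> g x \<in> V"
    and conj: "\<And>x. x \<in> V \<Longrightarrow> g (\<phi> x) = \<phi> (f x)"
  shows "endo_trace V g = endo_trace V f"
proof -
  let ?\<psi> = "inv_into V \<phi>" and ?r = "representation basis"
  have \<psi>: "?\<psi> x \<in> V" "\<phi> (?\<psi> x) = x" if "x \<in> V" for x
    using that \<phi>(1) by (auto simp: bij_betw_def intro: inv_into_into f_inv_into_f)
  have \<psi>': "?\<psi> (\<phi> x) = x" if "x \<in> V" for x
    using that \<phi>(1) by (simp add: bij_betw_def)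
  have lin: "lin_on V (\<lambda>x. ?r (?\<psi> x) b)" for b
    by (rule lin_on_compose[OF lin_on_inv_into[OF V \<phi>] \<psi>(1) lin_on_representation])
  have "x = (\<Sum>b\<in>basis. ?r (?\<psi> x) b *\<^sub>R \<phi> b)" if "x \<in> V" for x
  proof -
    have "\<phi> (\<Sum>b\<in>basis. ?r (?\<psi> x) b *\<^sub>R b) = (\<Sum>b\<in>basis. ?r (?\<psi> x) b *\<^sub>R \<phi> b)"
      by (rule lin_on_sum[OF V \<phi>(2) finite_basis basis_in])
    then show ?thesis
      using basis_expansion[OF \<psi>(1)[OF that]] \<psi>(2)[OF that] by simp
  qed
  then have "endo_trace V g = (\<Sum>b\<in>basis. ?r (?\<psi> (g (\<phi> b))) b)"
    using \<phi>(1) basis_in lin g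
    by (intro endo_trace_dual_system finite_basis) (auto simp: bij_betw_def)
  also have "\<dots> = (\<Sum>b\<in>basis. ?r (f b) b)"
    by (intro sum.cong) (simp_all add: conj \<psi>' basis_in f)
  finally show ?thesis by (simp add: endo_trace_basis)
qed

lemma endo_trace_id: "endo_trace V (\<lambda>x. x) = real (dim V)"
proof -
  have "endo_trace V (\<lambda>x. x) = (\<Sum>b\<in>basis. 1)"
    unfolding endo_trace_basis
    by (intro sum.cong) (simp_all add: representation_basis independent_basis)
  moreover have "card basis = dim V"
    by (metis dim_eq_card independent_basis span_basis span_span)
  ultimately show ?thesis by simp
qed

lemma endo_trace_add:
  assumes "\<And>x. x \<in> V \<Longrightarrow> f x \<in> V" "\<And>x. x \<in> V \<Longrightarrow> g x \<in> V"
  shows "endo_trace V (\<lambda>x. f x + g x) = endo_trace V f + endo_trace V g"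
  unfolding endo_trace_basis
  by (simp add: representation_add independent_basis span_basis basis_in assms sum.distrib)

lemma endo_trace_scaleR:
  assumes "\<And>x. x \<in> V \<Longrightarrow> f x \<in> V"
  shows "endo_trace V (\<lambda>x. r *\<^sub>R f x) = r * endo_trace V f"
  unfolding endo_trace_basis
  by (simp add: representation_scale independent_basis span_basis basis_in assms sum_distrib_left)

end

lemma alg_autD:
  assumes "\<phi> \<in> alg_aut V m"
  shows "bij_betw \<phi> V V" "lin_on V \<phi>"
    and "x \<in> V \<Longrightarrow> \<phi> x \<in> V"
    and "x \<in> V \<Longrightarrow> y \<in> V \<Longrightarrow> \<phi> (m x y) = m (\<phi> x) (\<phi> y)"
    and "x \<in> V \<Longrightarrow> y \<in> V \<Longrightarrow> \<phi> (x + y) = \<phi> x + \<phi> y"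
    and "x \<in> V \<Longrightarrow> \<phi> (r *\<^sub>R x) = r *\<^sub>R \<phi> x"
  using assms unfolding alg_aut_def lin_on_def by (auto dest: bij_betwE)

lemma alg_aut_id: "(\<lambda>x. x) \<in> alg_aut V m"
  by (simp add: alg_aut_def lin_on_def bij_betw_def)

lemma alg_aut_compose:
  assumes "\<phi> \<in> alg_aut V m" "\<psi> \<in> alg_aut V m"
  shows "(\<lambda>x. \<psi> (\<phi> x)) \<in> alg_aut V m"
proof -
  have "bij_betw (\<lambda>x. \<psi> (\<phi> x)) V V"
    using bij_betw_trans[OF alg_autD(1)[OF assms(1)] alg_autD(1)[OF assms(2)]]
    by (simp add: comp_def)
  then show ?thesis
    unfolding alg_aut_def lin_on_def
    using alg_autD(3-6)[OF assms(1)] alg_autD(3-6)[OF assms(2)] by simp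
qed

lemma alg_autI:
  assumes "linear \<phi>" "\<And>x. x \<in> V \<Longrightarrow> \<phi> x \<in> V" "\<And>x. x \<in> V \<Longrightarrow> \<psi> x \<in> V"
    and "\<And>x. x \<in> V \<Longrightarrow> \<psi> (\<phi> x) = x" "\<And>x. x \<in> V \<Longrightarrow> \<phi> (\<psi> x) = x"
    and "\<And>x y. x \<in> V \<Longrightarrow> y \<in> V \<Longrightarrow> \<phi> (m x y) = m (\<phi> x) (\<phi> y)"
  shows "\<phi> \<in> alg_aut V m"
proof -
  have "bij_betw \<phi> V V"
    by (rule bij_betwI[where g = \<psi>]) (use assms in auto)
  then show ?thesis
    using assms by (simp add: alg_aut_def linear_imp_lin_on)
qed

text \<open>
  A positive definite form that all automorphisms preserve is what makes the automorphism group
  compact.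
\<close>

locale metric_algebra = finite_dimensional_subspace V
  for V :: "'v::real_vector set" +
  fixes m :: "'v \<Rightarrow> 'v \<Rightarrow> 'v" and h :: "'v \<Rightarrow> 'v \<Rightarrow> real"
  assumes linear_m: "linear (m x)" "linear (\<lambda>x. m x y)"
    and m_closed: "x \<in> V \<Longrightarrow> y \<in> V \<Longrightarrow> m x y \<in> V"
    and linear_h: "linear (h x)"
    and h_commute: "h x y = h y x"
    and h_pos: "x \<in> V \<Longrightarrow> x \<noteq> 0 \<Longrightarrow> h x x > 0"
    and aut_isometry: "\<phi> \<in> alg_aut V m \<Longrightarrow> x \<in> V \<Longrightarrow> y \<in> V \<Longrightarrow> h (\<phi> x) (\<phi> y) = h x y"
begin

lemma linear_h': "linear (\<lambda>x. h x y)"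
proof -
  have "(\<lambda>x. h x y) = h y" by (rule ext) (rule h_commute)
  then show ?thesis using linear_h[of y] by simp
qed

lemmas h_simps = linear_add[OF linear_h] linear_scale[OF linear_h] linear_0[OF linear_h]
  linear_diff[OF linear_h] linear_sum[OF linear_h]
  linear_add[OF linear_h'] linear_scale[OF linear_h'] linear_0[OF linear_h']
  linear_diff[OF linear_h'] linear_sum[OF linear_h']

text \<open>
  This is the Gram--Schmidt process, phrased through the expansion formula that an orthonormal basis
  satisfies: the formula passes from a span to the span with one more vector.
\<close>

lemma parseval_frame_exists:
  "\<exists>E. finite E \<and> E \<subseteq> V \<and> (\<forall>x\<in>V. x = (\<Sum>e\<in>E. h x e *\<^sub>R e))"
proof -
  have "\<exists>E. finite E \<and> E \<subseteq> span S \<and> (\<forall>x\<in>span S. x = (\<Sum>e\<in>E. h x e *\<^sub>R e))"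
    if "finite S" "S \<subseteq> V" for S
    using that
  proof (induction S rule: finite_induct)
    case empty
    then show ?case by (intro exI[of _ "{}"]) auto
  next
    case (insert v S)
    then obtain E where E: "finite E" "E \<subseteq> span S" "\<And>x. x \<in> span S \<Longrightarrow> x = (\<Sum>e\<in>E. h x e *\<^sub>R e)"
      by auto
    define p where "p = (\<Sum>e\<in>E. h v e *\<^sub>R e)"
    define w where "w = v - p"
    have p: "p \<in> span S"
      unfolding p_def using E(2) by (intro span_sum span_scale) auto
    have w_orth: "h w e = 0" if "e \<in> span S" for e
    proof -
      have "h p e = (\<Sum>d\<in>E. h v d * h d e)"
        by (simp add: p_def h_simps)
      also have "\<dots> = h v (\<Sum>d\<in>E. h e d *\<^sub>R d)"
        by (simp add: h_simps h_commute[of e] mult.commute)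
      finally show ?thesis
        using E(3)[OF that] by (simp add: w_def h_simps)
    qed
    have span: "\<exists>c s. s \<in> span S \<and> x = c *\<^sub>R w + s" if x: "x \<in> span (insert v S)" for x
    proof -
      obtain c where c: "x - c *\<^sub>R v \<in> span S"
        using x span_breakdown_eq by blast
      have "x = c *\<^sub>R w + ((x - c *\<^sub>R v) + c *\<^sub>R p)"
        by (simp add: w_def scaleR_diff_right)
      moreover have "(x - c *\<^sub>R v) + c *\<^sub>R p \<in> span S"
        using c p by (intro span_add span_scale)
      ultimately show ?thesis by blast
    qed
    have sub: "span S \<subseteq> span (insert v S)"
      by (rule span_mono) auto
    show ?case
    proof (cases "w = 0")
      case True
      then have "span (insert v S) \<subseteq> span S"
        using span by (metis add_0 scaleR_zero_right subsetI)
      then show ?thesis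
        using E sub by blast
    next
      case False
      have w_in: "w \<in> span (insert v S)"
        unfolding w_def using p sub by (intro span_diff) (auto intro: span_base)
      have "span (insert v S) \<subseteq> V"
        using insert.prems V by (rule span_minimal)
      then have pos: "h w w > 0"
        using w_in False h_pos by blast
      define k where "k = 1 / sqrt (h w w)"
      have kk: "k * k * h w w = 1"
        using pos by (simp add: k_def field_simps)
      have w_notin: "k *\<^sub>R w \<notin> E"
      proof
        assume "k *\<^sub>R w \<in> E"
        then have "h w (k *\<^sub>R w) = 0" using E(2) w_orth by blast
        then show False using kk by (auto simp: h_simps)
      qed
      show ?thesis
      proof (intro exI[of _ "insert (k *\<^sub>R w) E"] conjI ballI)
        show "insert (k *\<^sub>R w) E \<subseteq> span (insert v S)"
          using E(2) sub w_in by (auto intro: span_scale)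
        fix x assume "x \<in> span (insert v S)"
        then obtain c s where s: "s \<in> span S" and x: "x = c *\<^sub>R w + s"
          using span by blast
        have 1: "h x (k *\<^sub>R w) *\<^sub>R (k *\<^sub>R w) = c *\<^sub>R w"
        proof -
          have "h x (k *\<^sub>R w) * k = c * (k * k * h w w)"
            using w_orth[OF s] by (simp add: x h_simps h_commute[of s])
          then show ?thesis by (simp add: kk)
        qed
        have 2: "(\<Sum>e\<in>E. h x e *\<^sub>R e) = s"
        proof -
          have "h x e = h s e" if "e \<in> E" for e
            using w_orth[of e] that E(2) by (auto simp: x h_simps)
          then have "(\<Sum>e\<in>E. h x e *\<^sub>R e) = (\<Sum>e\<in>E. h s e *\<^sub>R e)" by simp
          then show ?thesis using E(3)[OF s] by simp
        qed
        show "x = (\<Sum>e\<in>insert (k *\<^sub>R w) E. h x e *\<^sub>R e)"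
          unfolding sum.insert[OF E(1) w_notin] 1 2 by (rule x)
      qed (use E in simp)
    qed
  qed
  from this[OF finite_basis] show ?thesis
    using span_basis basis_in by auto
qed

definition frame :: "'v set"
  where "frame = (SOME E. finite E \<and> E \<subseteq> V \<and> (\<forall>x\<in>V. x = (\<Sum>e\<in>E. h x e *\<^sub>R e)))"

lemma finite_frame: "finite frame"
  and frame_in: "e \<in> frame \<Longrightarrow> e \<in> V"
  and frame_expansion: "x \<in> V \<Longrightarrow> x = (\<Sum>e\<in>frame. h x e *\<^sub>R e)"
  using someI_ex[OF parseval_frame_exists] unfolding frame_def[symmetric] by blast+

lemma span_frame: "x \<in> V \<Longrightarrow> x \<in> span frame"
  using frame_expansion[of x] by (metis (no_types, lifting) span_base span_scale span_sum)

lemma frame_eqI: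
  assumes "x \<in> V" "y \<in> V" "\<And>d. d \<in> frame \<Longrightarrow> h x d = h y d"
  shows "x = y"
  using frame_expansion[OF assms(1)] frame_expansion[OF assms(2)] assms(3) by simp

definition frame_map :: "('v \<times> 'v \<Rightarrow> real) \<Rightarrow> 'v \<Rightarrow> 'v"
  where "frame_map w x = (\<Sum>e\<in>frame. \<Sum>f\<in>frame. (h x e * w (e, f)) *\<^sub>R f)"

lemma linear_frame_map: "linear (frame_map w)"
  by (rule linearI)
    (simp_all add: frame_map_def h_simps distrib_right scaleR_add_left sum.distrib
      scaleR_sum_right mult.assoc)

lemma frame_map_in: "frame_map w x \<in> V"
  unfolding frame_map_def using V frame_in by (intro subspace_sum subspace_scale) auto

definition matrix_of :: "('v \<Rightarrow> 'v) \<Rightarrow> 'v \<times> 'v \<Rightarrow> real"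
  where "matrix_of \<phi> = (\<lambda>(e, f). if e \<in> frame \<and> f \<in> frame then h (\<phi> e) f else 0)"

lemma frame_map_matrix_of:
  assumes "lin_on V \<phi>" "\<And>x. x \<in> V \<Longrightarrow> \<phi> x \<in> V" "x \<in> V"
  shows "frame_map (matrix_of \<phi>) x = \<phi> x"
proof -
  have "frame_map (matrix_of \<phi>) x = (\<Sum>e\<in>frame. h x e *\<^sub>R (\<Sum>f\<in>frame. h (\<phi> e) f *\<^sub>R f))"
    by (simp add: frame_map_def matrix_of_def scaleR_sum_right)
  also have "\<dots> = (\<Sum>e\<in>frame. h x e *\<^sub>R \<phi> e)"
    using frame_expansion[symmetric] assms(2) frame_in by (intro sum.cong) auto
  also have "\<dots> = \<phi> (\<Sum>e\<in>frame. h x e *\<^sub>R e)"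
    by (rule lin_on_sum[OF V assms(1) finite_frame frame_in, symmetric])
  finally show ?thesis using frame_expansion[OF assms(3)] by simp
qed

text \<open>
  The matrices of automorphisms in the frame, as a closed subset of a product of compact intervals.
  An automorphism is an isometry, so the transposed matrix belongs to its inverse; demanding that the
  two be mutually inverse makes bijectivity a closed condition.
\<close>

definition aut_matrices :: "('v \<times> 'v \<Rightarrow> real) set"
  where "aut_matrices =
    (\<Pi>\<^sub>E p\<in>UNIV. case p of (e, f) \<Rightarrow>
       if e \<in> frame \<and> f \<in> frame then {- (h e e + h f f)..h e e + h f f} else {0}) \<inter>
    {w. \<forall>a\<in>frame. \<forall>d\<in>frame.
       (\<forall>b\<in>frame. h (frame_map w (m a b)) d = h (m (frame_map w a) (frame_map w b)) d) \<and>
       h (frame_map w (frame_map (w \<circ> prod.swap) a)) d = h a d \<and>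
       h (frame_map (w \<circ> prod.swap) (frame_map w a)) d = h a d}"

lemma continuous_frame_map:
  assumes "\<And>d. continuous_on UNIV (\<lambda>w. h (X w) d)" "\<And>p. continuous_on UNIV (\<lambda>w. W w p)"
  shows "continuous_on UNIV (\<lambda>w. h (frame_map (W w) (X w)) d)"
  unfolding frame_map_def h_simps by (intro continuous_intros assms)

lemma continuous_m_frame_map:
  assumes "\<And>f. continuous_on UNIV (\<lambda>w. h (m f (X w)) d)"
  shows "continuous_on UNIV (\<lambda>w. h (m (frame_map w a) (X w)) d)"
  unfolding frame_map_def linear_sum[OF linear_m(2)] linear_scale[OF linear_m(2)] h_simps
  by (intro continuous_intros assms continuous_on_product_coordinates)

lemma continuous_m_frame_map':
  "continuous_on UNIV (\<lambda>w. h (m f (frame_map w b)) d)"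
  unfolding frame_map_def linear_sum[OF linear_m(1)] linear_scale[OF linear_m(1)] h_simps
  by (intro continuous_intros continuous_on_product_coordinates)

lemma closed_Collect_ball:
  "(\<And>a. a \<in> A \<Longrightarrow> closed {x. P a x}) \<Longrightarrow> closed {x. \<forall>a\<in>A. P a x}"
  by (simp add: Collect_ball_eq closed_INT)

lemma compact_aut_matrices: "compact aut_matrices"
proof -
  have swap: "continuous_on UNIV (\<lambda>w :: 'v \<times> 'v \<Rightarrow> real. (w \<circ> prod.swap) p)" for p
    by simp
  have "compactin (product_topology (\<lambda>_. euclideanreal) UNIV)
    (\<Pi>\<^sub>E p\<in>UNIV. case p of (e, f) \<Rightarrow>
       if e \<in> frame \<and> f \<in> frame then {- (h e e + h f f)..h e e + h f f} else {0})"
    by (subst compactin_PiE) (auto split: prod.splits)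
  then show ?thesis
    unfolding aut_matrices_def euclidean_product_topology compactin_euclidean_iff
    by (intro compact_Int_closed closed_Collect_ball closed_Collect_conj closed_Collect_eq
        continuous_frame_map continuous_m_frame_map continuous_m_frame_map' swap
        continuous_on_const continuous_on_product_coordinates)
qed

lemma aut_matrices_imp_alg_aut:
  assumes "w \<in> aut_matrices"
  shows "frame_map w \<in> alg_aut V m"
proof (rule alg_autI[where \<psi> = "frame_map (w \<circ> prod.swap)"])
  have inv: "frame_map w (frame_map (w \<circ> prod.swap) a) = a"
    "frame_map (w \<circ> prod.swap) (frame_map w a) = a" if "a \<in> frame" for a
    using assms that by (auto intro!: frame_eqI frame_map_in frame_in simp: aut_matrices_def)
  show "frame_map (w \<circ> prod.swap) (frame_map w x) = x" if "x \<in> V" for x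
    using linear_eq_on[OF linear_compose[OF linear_frame_map linear_frame_map] linear_id
        span_frame[OF that]] inv(2) by simp
  show "frame_map w (frame_map (w \<circ> prod.swap) x) = x" if "x \<in> V" for x
    using linear_eq_on[OF linear_compose[OF linear_frame_map linear_frame_map] linear_id
        span_frame[OF that]] inv(1) by simp
  have m_frame: "frame_map w (m a b) = m (frame_map w a) (frame_map w b)"
    if "a \<in> frame" "b \<in> frame" for a b
    using assms that by (auto intro!: frame_eqI frame_map_in m_closed simp: aut_matrices_def)
  have "frame_map w (m a y) = m (frame_map w a) (frame_map w y)" if "a \<in> frame" "y \<in> V" for a y
    using linear_eq_on[OF linear_compose[OF linear_m(1) linear_frame_map]
        linear_compose[OF linear_frame_map linear_m(1)] span_frame[OF that(2)]]
      m_frame[OF that(1)] by simp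
  then show "frame_map w (m x y) = m (frame_map w x) (frame_map w y)" if "x \<in> V" "y \<in> V" for x y
    using linear_eq_on[OF linear_compose[OF linear_m(2) linear_frame_map]
        linear_compose[OF linear_frame_map linear_m(2)] span_frame[OF that(1)]] that(2) by simp
qed (auto intro: linear_frame_map frame_map_in)

lemma abs_h_le: "x \<in> V \<Longrightarrow> y \<in> V \<Longrightarrow> \<bar>h x y\<bar> \<le> h x x + h y y"
proof -
  assume xy: "x \<in> V" "y \<in> V"
  have nonneg: "0 \<le> h z z" if "z \<in> V" for z
    using h_pos[OF that] by (cases "z = 0") (auto simp: h_simps)
  have "0 \<le> h (x + y) (x + y)" "0 \<le> h (x - y) (x - y)" "0 \<le> h x x" "0 \<le> h y y"
    using xy V by (auto intro!: nonneg subspace_add subspace_diff)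
  then show ?thesis
    by (simp add: h_simps h_commute[of y x])
qed

lemma matrix_of_alg_aut:
  assumes "\<phi> \<in> alg_aut V m"
  shows "matrix_of \<phi> \<in> aut_matrices"
proof -
  note \<phi> = alg_autD[OF assms]
  let ?\<psi> = "inv_into V \<phi>"
  have \<psi>: "?\<psi> x \<in> V" "\<phi> (?\<psi> x) = x" "?\<psi> (\<phi> x) = x" if "x \<in> V" for x
    using that \<phi>(1) by (auto simp: bij_betw_def intro: inv_into_into f_inv_into_f)
  have 1: "frame_map (matrix_of \<phi>) x = \<phi> x" if "x \<in> V" for x
    using frame_map_matrix_of \<phi>(2,3) that by blast
  have "matrix_of \<phi> \<circ> prod.swap = matrix_of ?\<psi>"
  proof -
    have "h (\<phi> f) e = h (?\<psi> e) f" if "e \<in> frame" "f \<in> frame" for e f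
      using aut_isometry[OF assms, of f "?\<psi> e"] that \<psi> frame_in by (metis h_commute)
    then show ?thesis by (auto simp: matrix_of_def fun_eq_iff)
  qed
  then have 2: "frame_map (matrix_of \<phi> \<circ> prod.swap) x = ?\<psi> x" if "x \<in> V" for x
    using frame_map_matrix_of[OF lin_on_inv_into[OF V \<phi>(1,2)] \<psi>(1)] that by simp
  have "- (h e e + h f f) \<le> h (\<phi> e) f \<and> h (\<phi> e) f \<le> h e e + h f f"
    if "e \<in> frame" "f \<in> frame" for e f
    using abs_h_le[of "\<phi> e" f] aut_isometry[OF assms, of e e] that frame_in \<phi>(3)
    by (simp add: abs_le_iff)
  then have "matrix_of \<phi> \<in> (\<Pi>\<^sub>E p\<in>UNIV. case p of (e, f) \<Rightarrow>
       if e \<in> frame \<and> f \<in> frame then {- (h e e + h f f)..h e e + h f f} else {0})"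
    by (auto simp: PiE_iff matrix_of_def split: prod.splits)
  then show ?thesis
    by (simp add: aut_matrices_def 1 2 \<psi> \<phi> frame_in m_closed)
qed

text \<open>
  A continuous function on a compact set attains its maximum. The sum of squares of coordinates is the
  function that detects diagonality later.
\<close>

lemma aut_orbit_maximiser:
  assumes x: "x \<in> V" and D: "finite D" "D \<subseteq> V"
  shows "\<exists>\<phi>\<in>alg_aut V m. \<forall>\<psi>\<in>alg_aut V m.
    (\<Sum>d\<in>D. (h (\<psi> x) d)\<^sup>2) \<le> (\<Sum>d\<in>D. (h (\<phi> x) d)\<^sup>2)"
proof -
  have "continuous_on aut_matrices (\<lambda>w. \<Sum>d\<in>D. (h (frame_map w x) d)\<^sup>2)"
    by (rule continuous_on_subset[OF _ subset_UNIV])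
      (intro continuous_intros continuous_frame_map continuous_on_product_coordinates)
  moreover have "aut_matrices \<noteq> {}"
    using matrix_of_alg_aut[OF alg_aut_id] by auto
  ultimately obtain w where w: "w \<in> aut_matrices"
    "\<And>v. v \<in> aut_matrices \<Longrightarrow>
      (\<Sum>d\<in>D. (h (frame_map v x) d)\<^sup>2) \<le> (\<Sum>d\<in>D. (h (frame_map w x) d)\<^sup>2)"
    using continuous_attains_sup[OF compact_aut_matrices] by blast
  show ?thesis
  proof (intro bexI[OF _ aut_matrices_imp_alg_aut[OF w(1)]] ballI)
    fix \<psi> assume \<psi>: "\<psi> \<in> alg_aut V m"
    then show "(\<Sum>d\<in>D. (h (\<psi> x) d)\<^sup>2) \<le> (\<Sum>d\<in>D. (h (frame_map w x) d)\<^sup>2)"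
      using w(2)[OF matrix_of_alg_aut[OF \<psi>]] frame_map_matrix_of[OF alg_autD(2,3)[OF \<psi>] x]
      by simp
  qed
qed

end

section \<open>Hermitian matrices and real orthogonal automorphisms\<close>

lemma mat_prod_nth: "mat_prod x y $ i $ j = (\<Sum>k\<in>UNIV. x $ i $ k * y $ k $ j)"
  by (simp add: mat_prod_def)

lemma linear_mat_prod: "linear (mat_prod x)" "linear (\<lambda>x. mat_prod x y)"
  by (rule linearI;
      simp add: vec_eq_iff mat_prod_nth sum.distrib scaleR_sum_right)+

lemma jordan_commute: "x \<star> y = y \<star> x"
  by (simp add: jordan_def add.commute)

lemma linear_jordan:
  fixes x y :: "'a::star_algebra^'n^'n"
  shows "linear (\<lambda>y. x \<star> y)" "linear (\<lambda>x. x \<star> y)"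
proof -
  show 1: "linear (\<lambda>y. x \<star> y)" for x :: "'a^'n^'n"
    unfolding jordan_def
    by (intro linear_compose_scale_right linear_compose_add linear_mat_prod)
  show "linear (\<lambda>x. x \<star> y)"
    using 1[of y] by (simp add: jordan_commute[of _ y])
qed

lemma jordan_nth:
  "(x \<star> y) $ i $ j = (1 / 2) *\<^sub>R (\<Sum>k\<in>UNIV. x $ i $ k * y $ k $ j + y $ i $ k * x $ k $ j)"
  by (simp add: jordan_def mat_prod_nth sum.distrib)

lemma mem_Herm: "x \<in> Herm \<longleftrightarrow> (\<forall>i j. bar (x $ j $ i) = x $ i $ j)"
  by (simp add: Herm_def)

lemma subspace_Herm: "subspace (Herm :: ('a::star_algebra^'n^'n) set)"
  by (simp add: subspace_def mem_Herm)

lemma jordan_Herm: "x \<in> Herm \<Longrightarrow> y \<in> Herm \<Longrightarrow> x \<star> y \<in> Herm"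
  by (simp add: mem_Herm jordan_nth bar_sum add.commute)

definition entry :: "'n \<Rightarrow> 'n \<Rightarrow> 'a \<Rightarrow> 'a::zero^'n^'n"
  where "entry i j a = (\<chi> k l. if k = i \<and> l = j then a else 0)"

lemma mat_unit_eq: "mat_unit i j = entry i j 1"
  by (simp add: mat_unit_def entry_def)

lemma linear_entry: "linear (entry i j :: 'a::real_vector \<Rightarrow> 'a^'n^'n)"
  by (rule linearI) (simp_all add: entry_def vec_eq_iff)

lemma entry_expansion: "x = (\<Sum>i\<in>UNIV. \<Sum>j\<in>UNIV. entry i j (x $ i $ j))"
proof -
  have "(\<Sum>i\<in>UNIV. \<Sum>j\<in>UNIV. entry i j (x $ i $ j) $ k $ l) =
      (\<Sum>i\<in>UNIV. if i = k then \<Sum>j\<in>UNIV. if j = l then x $ i $ j else 0 else 0)" for k l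
    by (intro sum.cong) (auto simp: entry_def intro!: sum.cong)
  then show ?thesis by (simp add: vec_eq_iff)
qed

definition trace_form :: "'a::star_algebra^'n^'n \<Rightarrow> 'a^'n^'n \<Rightarrow> real"
  where "trace_form x y = (\<Sum>i\<in>UNIV. \<Sum>j\<in>UNIV. re (x $ i $ j * y $ j $ i)) / real CARD('n)"

definition reindex :: "('n \<Rightarrow> 'n) \<Rightarrow> 'a^'n^'n \<Rightarrow> 'a^'n^'n"
  where "reindex \<pi> x = (\<chi> i j. x $ \<pi> i $ \<pi> j)"

lemma reindex_nth [simp]: "reindex \<pi> x $ i $ j = x $ \<pi> i $ \<pi> j"
  by (simp add: reindex_def)

lemma reindex_aut:
  assumes "bij \<pi>"
  shows "reindex \<pi> \<in> alg_aut (Herm :: ('a::star_algebra^'n^'n) set) (\<star>)"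
proof (rule alg_autI[where \<psi> = "reindex (inv \<pi>)"])
  show "linear (reindex \<pi> :: 'a^'n^'n \<Rightarrow> 'a^'n^'n)"
    by (rule linearI) (simp_all add: vec_eq_iff)
  show "reindex \<pi> (x \<star> y) = reindex \<pi> x \<star> reindex \<pi> y" for x y :: "'a^'n^'n"
    using sum.reindex_bij_betw[OF assms, of "\<lambda>k. x $ _ $ k * y $ k $ _ + y $ _ $ k * x $ k $ _"]
    by (simp add: vec_eq_iff jordan_nth)
qed (use assms in \<open>auto simp: mem_Herm vec_eq_iff bij_is_inj bij_is_surj surj_f_inv_f\<close>)

definition left_real :: "('n \<Rightarrow> 'n \<Rightarrow> real) \<Rightarrow> 'a::star_algebra^'n^'n \<Rightarrow> 'a^'n^'n"
  where "left_real U x = (\<chi> r s. \<Sum>k\<in>UNIV. U r k *\<^sub>R x $ k $ s)"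

definition right_real :: "('n \<Rightarrow> 'n \<Rightarrow> real) \<Rightarrow> 'a::star_algebra^'n^'n \<Rightarrow> 'a^'n^'n"
  where "right_real U x = (\<chi> r s. \<Sum>l\<in>UNIV. U s l *\<^sub>R x $ r $ l)"

lemma real_nth [simp]:
  "left_real U x $ r $ s = (\<Sum>k\<in>UNIV. U r k *\<^sub>R x $ k $ s)"
  "right_real U x $ r $ s = (\<Sum>l\<in>UNIV. U s l *\<^sub>R x $ r $ l)"
  by (simp_all add: left_real_def right_real_def)

lemma linear_left_real: "linear (left_real U)" and linear_right_real: "linear (right_real U)"
  by (rule linearI; simp add: vec_eq_iff scaleR_add_right sum.distrib scaleR_sum_right
      mult.commute)+

lemma sum_kronecker:
  fixes f :: "'n::finite \<Rightarrow> 'a::real_vector"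
  shows "(\<Sum>k\<in>UNIV. (if r = k then 1 else 0) *\<^sub>R f k) = f r"
    and "(\<Sum>k\<in>UNIV. (if k = r then 1 else 0) *\<^sub>R f k) = f r"
proof -
  have "(\<Sum>k\<in>UNIV. (if r = k then 1 else 0) *\<^sub>R f k) = (\<Sum>k\<in>UNIV. if r = k then f k else 0)"
    by (intro sum.cong) auto
  then show "(\<Sum>k\<in>UNIV. (if r = k then 1 else 0) *\<^sub>R f k) = f r" by simp
  then show "(\<Sum>k\<in>UNIV. (if k = r then 1 else 0) *\<^sub>R f k) = f r"
    by (simp only: eq_commute[of _ r])
qed

lemma left_right_real_commute: "left_real U (right_real W x) = right_real W (left_real U x)"
proof -
  have "(\<Sum>k\<in>UNIV. \<Sum>l\<in>UNIV. (U r k * W s l) *\<^sub>R x $ k $ l) =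
      (\<Sum>l\<in>UNIV. \<Sum>k\<in>UNIV. (W s l * U r k) *\<^sub>R x $ k $ l)" for r s
    by (subst sum.swap) (simp add: mult.commute)
  then show ?thesis by (simp add: vec_eq_iff scaleR_sum_right)
qed

lemma mat_prod_left_real: "mat_prod (left_real U x) y = left_real U (mat_prod x y)"
proof -
  have "(\<Sum>k\<in>UNIV. \<Sum>p\<in>UNIV. U r p *\<^sub>R (x $ p $ k * y $ k $ s)) =
      (\<Sum>p\<in>UNIV. \<Sum>k\<in>UNIV. U r p *\<^sub>R (x $ p $ k * y $ k $ s))" for r s
    by (rule sum.swap)
  then show ?thesis
    by (simp add: vec_eq_iff mat_prod_nth star_sum_left scaleR_sum_right)
qed

lemma mat_prod_right_real: "mat_prod x (right_real U y) = right_real U (mat_prod x y)"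
proof -
  have "(\<Sum>k\<in>UNIV. \<Sum>p\<in>UNIV. U s p *\<^sub>R (x $ r $ k * y $ k $ p)) =
      (\<Sum>p\<in>UNIV. \<Sum>k\<in>UNIV. U s p *\<^sub>R (x $ r $ k * y $ k $ p))" for r s
    by (rule sum.swap)
  then show ?thesis
    by (simp add: vec_eq_iff mat_prod_nth star_sum_right scaleR_sum_right)
qed

context
  fixes U :: "'n::finite \<Rightarrow> 'n \<Rightarrow> real"
  assumes sym: "\<And>r s. U r s = U s r"
    and involution: "\<And>r s. (\<Sum>k\<in>UNIV. U r k * U k s) = (if r = s then 1 else 0)"
begin

lemma left_real_involution: "left_real U (left_real U x) = x"
proof -
  have "(\<Sum>k\<in>UNIV. \<Sum>p\<in>UNIV. (U r k * U k p) *\<^sub>R x $ p $ s) = x $ r $ s" for r s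
    by (subst sum.swap) (simp add: involution sum_kronecker flip: scaleR_sum_left)
  then show ?thesis by (simp add: vec_eq_iff scaleR_sum_right)
qed

lemma right_real_involution: "right_real U (right_real U x) = x"
proof -
  have "(\<Sum>k\<in>UNIV. \<Sum>p\<in>UNIV. (U s k * U k p) *\<^sub>R x $ r $ p) = x $ r $ s" for r s
    by (subst sum.swap) (simp add: involution sum_kronecker flip: scaleR_sum_left)
  then show ?thesis by (simp add: vec_eq_iff scaleR_sum_right)
qed

lemma mat_prod_right_left_real: "mat_prod (right_real U x) (left_real U y) = mat_prod x y"
proof -
  have "(\<Sum>k\<in>UNIV. (\<Sum>l\<in>UNIV. U k l *\<^sub>R x $ r $ l) * (\<Sum>p\<in>UNIV. U k p *\<^sub>R y $ p $ s)) =
      (\<Sum>l\<in>UNIV. x $ r $ l * y $ l $ s)" for r s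
  proof -
    have "(\<Sum>k\<in>UNIV. (\<Sum>l\<in>UNIV. U k l *\<^sub>R x $ r $ l) * (\<Sum>p\<in>UNIV. U k p *\<^sub>R y $ p $ s)) =
        (\<Sum>k\<in>UNIV. \<Sum>l\<in>UNIV. \<Sum>p\<in>UNIV. (U l k * U k p) *\<^sub>R (x $ r $ l * y $ p $ s))"
      by (simp only: star_sum_left) (simp add: star_sum_right scaleR_sum_right sym mult.commute)
    also have "\<dots> = (\<Sum>l\<in>UNIV. \<Sum>p\<in>UNIV. \<Sum>k\<in>UNIV. (U l k * U k p) *\<^sub>R (x $ r $ l * y $ p $ s))"
      by (subst sum.swap) (intro sum.cong refl sum.swap)
    also have "\<dots> = (\<Sum>l\<in>UNIV. x $ r $ l * y $ l $ s)"
      by (simp add: involution sum_kronecker flip: scaleR_sum_left)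
    finally show ?thesis .
  qed
  then show ?thesis by (simp add: vec_eq_iff mat_prod_nth)
qed

text \<open>
  Real scalars associate and commute with everything, so conjugation by a real symmetric orthogonal
  matrix respects the matrix product even over the octonions.
\<close>

lemma real_involution_aut:
  "(\<lambda>x. left_real U (right_real U x)) \<in> alg_aut (Herm :: ('a::star_algebra^'n^'n) set) (\<star>)"
proof (rule alg_autI[where \<psi> = "\<lambda>x. left_real U (right_real U x)"])
  let ?\<phi> = "\<lambda>x :: 'a^'n^'n. left_real U (right_real U x)"
  show lin: "linear ?\<phi>"
    using linear_compose[OF linear_right_real linear_left_real, of U U] by (simp add: comp_def)
  have prod: "mat_prod (?\<phi> x) (?\<phi> y) = ?\<phi> (mat_prod x y)" for x y
    by (simp only: mat_prod_left_real mat_prod_right_left_real mat_prod_right_real)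
  show "?\<phi> (x \<star> y) = ?\<phi> x \<star> ?\<phi> y" for x y
    unfolding jordan_def prod linear_scale[OF lin] linear_add[OF lin] ..
  have herm: "?\<phi> x \<in> Herm" if x: "x \<in> Herm" for x
  proof -
    have "bar (x $ k $ l) = x $ l $ k" for k l
      using x by (simp add: mem_Herm)
    then have "bar (?\<phi> x $ s $ r) = (\<Sum>k\<in>UNIV. \<Sum>l\<in>UNIV. (U r l * U s k) *\<^sub>R x $ l $ k)" for r s
      by (simp add: bar_sum scaleR_sum_right mult.commute)
    also have "\<dots> r s = ?\<phi> x $ r $ s" for r s
      by (subst sum.swap) (simp add: scaleR_sum_right)
    finally show ?thesis by (simp add: mem_Herm)
  qed
  show "?\<phi> x \<in> Herm" "?\<phi> x \<in> Herm" if "x \<in> Herm" for x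
    using that by (rule herm)+
  show "?\<phi> (?\<phi> x) = x" "?\<phi> (?\<phi> x) = x" for x
    by (simp_all only: left_right_real_commute left_real_involution right_real_involution)
qed

end

text \<open>
  The matrix of the reflection in the hyperplane orthogonal to the unit vector \<open>w\<close>.
\<close>

definition reflection :: "('n \<Rightarrow> real) \<Rightarrow> 'n \<Rightarrow> 'n \<Rightarrow> real"
  where "reflection w r s = (if r = s then 1 else 0) - 2 * w r * w s"

definition reflect :: "('n \<Rightarrow> real) \<Rightarrow> 'a::star_algebra^'n^'n \<Rightarrow> 'a^'n^'n"
  where "reflect w x = left_real (reflection w) (right_real (reflection w) x)"

lemma reflect_aut:
  assumes "(\<Sum>k\<in>UNIV. (w k)\<^sup>2) = 1"
  shows "reflect w \<in> alg_aut (Herm :: ('a::star_algebra^'n^'n) set) (\<star>)"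
proof -
  have "(\<Sum>k\<in>UNIV. reflection w r k * reflection w k s) = (if r = s then 1 else 0)" for r s
  proof -
    have "reflection w r k * reflection w k s =
        (if r = k then 1 else 0) *\<^sub>R (if k = s then 1 else 0)
        - (if r = k then 1 else 0) *\<^sub>R (2 * w k * w s)
        - (if k = s then 1 else 0) *\<^sub>R (2 * w r * w k) + 4 * w r * w s * (w k)\<^sup>2" for k
      by (simp add: reflection_def power2_eq_square algebra_simps)
    then have "(\<Sum>k\<in>UNIV. reflection w r k * reflection w k s) =
        (if r = s then 1 else 0) - 4 * w r * w s + 4 * w r * w s * (\<Sum>k\<in>UNIV. (w k)\<^sup>2)"
      by (simp only: sum.distrib sum_subtractf sum_kronecker sum_distrib_left)
    then show ?thesis using assms by simp
  qed
  moreover have "reflection w r s = reflection w s r" for r s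
    by (auto simp: reflection_def)
  ultimately show ?thesis
    unfolding reflect_def by (intro real_involution_aut)
qed

lemma sum_two_points:
  fixes f :: "'n::finite \<Rightarrow> 'a::comm_monoid_add"
  assumes "i \<noteq> j" "\<And>k. k \<noteq> i \<Longrightarrow> k \<noteq> j \<Longrightarrow> f k = 0"
  shows "(\<Sum>k\<in>UNIV. f k) = f i + f j"
proof -
  have "(\<Sum>k\<in>UNIV. f k) = (\<Sum>k\<in>{i, j}. f k)"
    by (rule sum.mono_neutral_right) (use assms(2) in auto)
  then show ?thesis using assms(1) by simp
qed

lemma plane_reflection_nth:
  fixes x :: "'a::star_algebra^'n^'n"
  assumes "i \<noteq> j" "\<forall>k. k \<noteq> i \<and> k \<noteq> j \<longrightarrow> w k = 0"
  shows "right_real (reflection w) x $ r $ s =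
      x $ r $ s - (2 * w s) *\<^sub>R (w i *\<^sub>R x $ r $ i + w j *\<^sub>R x $ r $ j)"
    and "left_real (reflection w) x $ r $ s =
      x $ r $ s - (2 * w r) *\<^sub>R (w i *\<^sub>R x $ i $ s + w j *\<^sub>R x $ j $ s)"
proof -
  have "(\<Sum>k\<in>UNIV. reflection w r k *\<^sub>R f k) =
      f r - (2 * w r) *\<^sub>R (w i *\<^sub>R f i + w j *\<^sub>R f j)" for r and f :: "'n \<Rightarrow> 'a"
  proof -
    have "(\<Sum>k\<in>UNIV. reflection w r k *\<^sub>R f k) =
        (\<Sum>k\<in>UNIV. (if r = k then 1 else 0) *\<^sub>R f k) - (\<Sum>k\<in>UNIV. (2 * w r * w k) *\<^sub>R f k)"
      unfolding sum_subtractf[symmetric]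
      by (intro sum.cong) (simp_all add: reflection_def scaleR_diff_left)
    also have "(\<Sum>k\<in>UNIV. (2 * w r * w k) *\<^sub>R f k) =
        (2 * w r * w i) *\<^sub>R f i + (2 * w r * w j) *\<^sub>R f j"
      by (rule sum_two_points) (use assms in auto)
    finally show ?thesis by (simp add: sum_kronecker scaleR_add_right)
  qed
  from this[of s "\<lambda>k. x $ r $ k"] this[of r "\<lambda>k. x $ k $ s"]
  show "right_real (reflection w) x $ r $ s =
      x $ r $ s - (2 * w s) *\<^sub>R (w i *\<^sub>R x $ r $ i + w j *\<^sub>R x $ r $ j)"
    "left_real (reflection w) x $ r $ s =
      x $ r $ s - (2 * w r) *\<^sub>R (w i *\<^sub>R x $ i $ s + w j *\<^sub>R x $ j $ s)"
    by simp_all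
qed

section \<open>The trace form\<close>

definition diag_conj :: "('n \<Rightarrow> 'a) \<Rightarrow> 'a::star_algebra^'n^'n \<Rightarrow> 'a^'n^'n"
  where "diag_conj d x = (\<chi> r s. d r * (x $ r $ s * bar (d s)))"

lemma diag_conj_nth [simp]: "diag_conj d x $ r $ s = d r * (x $ r $ s * bar (d s))"
  by (simp add: diag_conj_def)

context hurwitz
begin

lemma Herm_diagonal: "(x :: 'a^'n^'n) \<in> Herm \<Longrightarrow> x $ i $ i = re (x $ i $ i) *\<^sub>R 1"
  by (rule self_conjugate_eq) (simp add: mem_Herm)

lemma finite_dimensional_Herm: "finite_dimensional_subspace (Herm :: ('a^'n^'n) set)"
proof
  show "subspace (Herm :: ('a^'n^'n) set)" by (rule subspace_Herm)
  obtain F where F: "finite F" "span F = (UNIV :: 'a set)"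
    using finite_dimensional by blast
  let ?G = "\<Union>i. \<Union>j. entry i j ` F :: ('a^'n^'n) set"
  have "entry i j a \<in> span ?G" for i j and a :: 'a
  proof -
    have "entry i j a \<in> entry i j ` span F" using F(2) by blast
    also have "\<dots> \<subseteq> span ?G"
      unfolding linear_span_image[OF linear_entry, symmetric] by (rule span_mono) blast
    finally show ?thesis .
  qed
  then have "(\<Sum>i\<in>UNIV. \<Sum>j\<in>UNIV. entry i j (x $ i $ j)) \<in> span ?G" for x :: "'a^'n^'n"
    by (intro span_sum)
  then have "x \<in> span ?G" for x :: "'a^'n^'n"
    by (simp only: entry_expansion[symmetric])
  then show "\<exists>G. finite G \<and> (Herm :: ('a^'n^'n) set) \<subseteq> span G"
    using F(1) by (intro exI[of _ ?G]) auto
qed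

lemma linear_trace_form: "linear (trace_form (x :: 'a^'n^'n))"
  by (rule linearI)
    (simp_all add: trace_form_def sum.distrib add_divide_distrib sum_distrib_left)

lemma trace_form_commute: "trace_form (x :: 'a^'n^'n) y = trace_form y x"
  unfolding trace_form_def by (subst sum.swap) (simp add: re_mult_commute)

lemma trace_form_Herm:
  "y \<in> Herm \<Longrightarrow> trace_form (x :: 'a^'n^'n) y =
    (\<Sum>i\<in>UNIV. \<Sum>j\<in>UNIV. re (x $ i $ j * bar (y $ i $ j))) / real CARD('n)"
  by (simp add: trace_form_def mem_Herm)

lemma trace_form_self:
  "x \<in> Herm \<Longrightarrow> trace_form (x :: 'a^'n^'n) x =
    (\<Sum>i\<in>UNIV. \<Sum>j\<in>UNIV. nrm (x $ i $ j)) / real CARD('n)"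
  by (simp add: trace_form_Herm re_mult_self)

lemma trace_form_pos:
  assumes "x \<in> Herm" "(x :: 'a^'n^'n) \<noteq> 0"
  shows "trace_form x x > 0"
proof -
  obtain i j where "x $ i $ j \<noteq> 0" using assms(2) by (auto simp: vec_eq_iff)
  then have "0 < (\<Sum>j\<in>UNIV. nrm (x $ i $ j))"
    by (intro sum_pos2[of _ j] nrm_pos) auto
  then have "0 < (\<Sum>i\<in>UNIV. \<Sum>j\<in>UNIV. nrm (x $ i $ j))"
    by (intro sum_pos2[of _ i "\<lambda>i. \<Sum>j\<in>UNIV. nrm (x $ i $ j)"]) (auto intro: sum_nonneg)
  then show ?thesis by (simp add: trace_form_self[OF assms(1)])
qed

lemma trace_form_jordan: "trace_form (x :: 'a^'n^'n) y = (\<Sum>i\<in>UNIV. re ((x \<star> y) $ i $ i)) / real CARD('n)"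
proof -
  have "(\<Sum>i\<in>UNIV. re ((x \<star> y) $ i $ i)) =
      (1 / 2) * ((\<Sum>i\<in>UNIV. \<Sum>k\<in>UNIV. re (x $ i $ k * y $ k $ i)) +
                 (\<Sum>i\<in>UNIV. \<Sum>k\<in>UNIV. re (y $ i $ k * x $ k $ i)))"
    by (simp add: jordan_nth re_sum sum.distrib sum_distrib_left)
  also have "(\<Sum>i\<in>UNIV. \<Sum>k\<in>UNIV. re (y $ i $ k * x $ k $ i)) =
      (\<Sum>i\<in>UNIV. \<Sum>k\<in>UNIV. re (x $ i $ k * y $ k $ i))"
    by (subst sum.swap) (simp add: re_mult_commute)
  finally show ?thesis by (simp add: trace_form_def)
qed

text \<open>
  Up to the factor \<open>1 / 2n\<close> both sides are sums of two triple traces; the real part of a triple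
  product is invariant under cyclic shifts.
\<close>

lemma trace_form_assoc: "trace_form (x \<star> y) (z :: 'a^'n^'n) = trace_form x (y \<star> z)"
proof -
  define t where "t x y z = (\<Sum>i\<in>UNIV. \<Sum>j\<in>UNIV. \<Sum>k\<in>UNIV.
      re (x $ i $ k * (y $ k $ j * z $ j $ i)))" for x y z :: "'a^'n^'n"
  have 1: "t y x z = t x z y"
  proof -
    have "t y x z = (\<Sum>i\<in>UNIV. \<Sum>j\<in>UNIV. \<Sum>k\<in>UNIV. re (x $ k $ j * (z $ j $ i * y $ i $ k)))"
      unfolding t_def by (intro sum.cong refl) (metis re_mult_commute re_mult_assoc)
    also have "\<dots> = (\<Sum>i\<in>UNIV. \<Sum>k\<in>UNIV. \<Sum>j\<in>UNIV. re (x $ k $ j * (z $ j $ i * y $ i $ k)))"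
      by (intro sum.cong refl sum.swap)
    also have "\<dots> = t x z y"
      unfolding t_def by (rule sum.swap)
    finally show ?thesis .
  qed
  have 2: "trace_form (x \<star> y) z = (1 / 2) * (t x y z + t y x z) / real CARD('n)"
    by (simp add: trace_form_def t_def jordan_nth star_sum_left re_sum re_mult_assoc sum.distrib
        sum_distrib_left)
  have t: "(\<Sum>i\<in>UNIV. \<Sum>k\<in>UNIV. \<Sum>j\<in>UNIV. re (x $ i $ k * (a $ k $ j * b $ j $ i))) = t x a b"
    for a b unfolding t_def by (intro sum.cong refl sum.swap)
  have 3: "trace_form x (y \<star> z) = (1 / 2) * (t x y z + t x z y) / real CARD('n)"
    by (simp add: trace_form_def jordan_nth star_sum_right re_sum sum.distrib t
        flip: sum_divide_distrib)
  show ?thesis by (simp add: 1 2 3)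
qed

definition herm_entry :: "'n \<Rightarrow> 'n \<Rightarrow> 'a \<Rightarrow> 'a^'n^'n"
  where "herm_entry i j a = entry i j a + entry j i (bar a)"

lemma herm_entry_Herm: "herm_entry (i :: 'n::finite) j a \<in> Herm"
proof -
  have "bar (entry k l b $ s $ r) = entry l k (bar b) $ r $ s" for k l r s :: 'n and b :: 'a
    by (simp add: entry_def conj_commute)
  then show ?thesis by (simp add: mem_Herm herm_entry_def add.commute)
qed

lemma herm_entry_expansion:
  assumes "x \<in> Herm"
  shows "x = (\<Sum>p\<in>UNIV. (1 / 2) *\<^sub>R herm_entry (fst p) (snd p) (x $ fst p $ snd p))"
proof -
  have "(\<Sum>p\<in>UNIV. (1 / 2) *\<^sub>R herm_entry (fst p) (snd p) (x $ fst p $ snd p)) =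
      (\<Sum>i\<in>UNIV. \<Sum>j\<in>UNIV. (1 / 2) *\<^sub>R herm_entry i j (x $ i $ j))"
    by (simp add: sum.cartesian_product flip: UNIV_Times_UNIV) (simp add: case_prod_beta)
  also have "\<dots> = (1 / 2) *\<^sub>R ((\<Sum>i\<in>UNIV. \<Sum>j\<in>UNIV. entry i j (x $ i $ j)) +
      (\<Sum>i\<in>UNIV. \<Sum>j\<in>UNIV. entry j i (x $ j $ i)))"
    using assms by (simp add: herm_entry_def mem_Herm sum.distrib scaleR_sum_right scaleR_add_right)
  also have "(\<Sum>i\<in>UNIV. \<Sum>j\<in>UNIV. entry j i (x $ j $ i)) = x"
    by (subst sum.swap) (rule entry_expansion[symmetric])
  also have "(\<Sum>i\<in>UNIV. \<Sum>j\<in>UNIV. entry i j (x $ i $ j)) = x"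
    by (rule entry_expansion[symmetric])
  finally show ?thesis by (simp flip: scaleR_2)
qed

text \<open>
  Changing the sign of the coordinate \<open>i\<close> negates every entry that joins \<open>i\<close> to another index.
\<close>

lemma sign_flip:
  assumes "i \<noteq> j"
  shows "\<exists>\<phi>\<in>alg_aut (Herm :: ('a^'n^'n) set) (\<star>). \<forall>a. \<phi> (herm_entry i j a) = - herm_entry i j a"
proof -
  define w :: "'n \<Rightarrow> real" where "w k = (if k = i then 1 else 0)" for k
  have w: "\<forall>k. k \<noteq> i \<and> k \<noteq> j \<longrightarrow> w k = 0"
    by (simp add: w_def)
  have "(\<Sum>k\<in>UNIV. (w k)\<^sup>2) = (w i)\<^sup>2 + (w j)\<^sup>2"
    by (rule sum_two_points) (use assms in \<open>auto simp: w_def\<close>)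
  then have "reflect w \<in> alg_aut (Herm :: ('a^'n^'n) set) (\<star>)"
    using assms by (intro reflect_aut) (simp add: w_def)
  moreover have "reflect w (herm_entry i j a) = - herm_entry i j a" for a
    unfolding reflect_def vec_eq_iff plane_reflection_nth[OF assms w]
    using assms by (auto simp: w_def herm_entry_def entry_def scaleR_2)
  ultimately show ?thesis by blast
qed

text \<open>
  The functional \<open>T z = tr L(z)\<close> satisfies \<open>T (\<phi> z) = T z\<close> for every automorphism \<open>\<phi>\<close>. Sign changes
  force it to vanish on off-diagonal matrices, transpositions of coordinates force equal values on the
  diagonal units, and the identity matrix has \<open>T = dim Herm\<close>.
\<close>

lemma endo_trace_jordan:
  assumes z: "(z :: 'a^'n^'n) \<in> Herm"
  shows "endo_trace Herm (\<lambda>y. z \<star> y) =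
    real (dim (Herm :: ('a^'n^'n) set)) / real CARD('n) * (\<Sum>i\<in>UNIV. re (z $ i $ i))"
    and "real (dim (Herm :: ('a^'n^'n) set)) \<noteq> 0"
proof -
  interpret finite_dimensional_subspace "Herm :: ('a^'n^'n) set"
    by (rule finite_dimensional_Herm)
  define T where "T z = endo_trace Herm (\<lambda>y. z \<star> y)" for z :: "'a^'n^'n"
  have T: "lin_on Herm T"
    unfolding lin_on_def T_def linear_add[OF linear_jordan(2)] linear_scale[OF linear_jordan(2)]
    by (simp add: endo_trace_add endo_trace_scaleR jordan_Herm)
  have T_aut: "T (\<phi> z) = T z" if "\<phi> \<in> alg_aut Herm (\<star>)" "z \<in> Herm" for \<phi> z
    unfolding T_def using alg_autD(3,4)[OF that(1)] that(2)
    by (intro endo_trace_conjugate[OF alg_autD(1,2)[OF that(1)]] linear_imp_lin_on linear_jordan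
        jordan_Herm) auto
  obtain i0 :: 'n where True by simp
  define t where "t = T (entry i0 i0 1)"
  have entry_Herm: "(entry i i 1 :: 'a^'n^'n) \<in> Herm" for i
    by (auto simp: mem_Herm entry_def)
  have diag: "T (entry i i 1) = t" for i
  proof -
    let ?\<pi> = "Transposition.transpose i i0"
    have "bij ?\<pi>" by simp
    then have "T (reindex ?\<pi> (entry i i 1)) = T (entry i i 1)"
      by (intro T_aut reindex_aut entry_Herm)
    moreover have "reindex ?\<pi> (entry i i 1) = (entry i0 i0 1 :: 'a^'n^'n)"
      by (auto simp: vec_eq_iff entry_def Transposition.transpose_def)
    ultimately show ?thesis by (simp add: t_def)
  qed
  have entry: "T (herm_entry i j a) = (if i = j then 2 * re a * t else 0)" for i j a
  proof (cases "i = j")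
    case True
    have "herm_entry i i a = (2 * re a) *\<^sub>R entry i i 1"
      unfolding herm_entry_def linear_scale[OF linear_entry, symmetric]
        linear_add[OF linear_entry, symmetric] add_bar ..
    then show ?thesis
      using True T diag entry_Herm by (simp add: lin_on_def)
  next
    case False
    obtain \<phi> where "\<phi> \<in> alg_aut Herm (\<star>)" "\<phi> (herm_entry i j a) = - herm_entry i j a"
      using sign_flip[OF False] by blast
    then have "T ((-1) *\<^sub>R herm_entry i j a) = T (herm_entry i j a)"
      using T_aut[OF _ herm_entry_Herm] by (metis scaleR_minus1_left)
    moreover have "T ((-1) *\<^sub>R herm_entry i j a) = - T (herm_entry i j a)"
      using T herm_entry_Herm unfolding lin_on_def by (metis scaleR_minus1_left)
    ultimately show ?thesis using False by simp
  qed
  have formula: "T z = t * (\<Sum>i\<in>UNIV. re (z $ i $ i))" if "z \<in> Herm" for z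
  proof -
    have "T z = T (\<Sum>p\<in>UNIV. (1 / 2) *\<^sub>R herm_entry (fst p) (snd p) (z $ fst p $ snd p))"
      using herm_entry_expansion[OF that] by simp
    also have "\<dots> = (\<Sum>p\<in>UNIV. (1 / 2) *\<^sub>R T (herm_entry (fst p) (snd p) (z $ fst p $ snd p)))"
      by (rule lin_on_sum[OF V T]) (auto intro: herm_entry_Herm)
    also have "\<dots> = (\<Sum>i\<in>UNIV. \<Sum>j\<in>UNIV. if i = j then re (z $ i $ i) * t else 0)"
      unfolding sum.cartesian_product UNIV_Times_UNIV
      by (intro sum.cong) (auto simp: entry)
    finally show ?thesis by (simp add: sum_distrib_left mult.commute)
  qed
  \<comment> \<open>The identity matrix acts as the identity, and the trace of the identity map is the dimension.\<close>
  define I :: "'a^'n^'n" where "I = (\<chi> i j. if i = j then 1 else 0)"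
  have I: "I \<in> Herm" by (simp add: I_def mem_Herm)
  have "I \<star> y = y" for y
  proof -
    have "(\<Sum>k\<in>UNIV. I $ i $ k * y $ k $ j) = (\<Sum>k\<in>UNIV. if i = k then y $ k $ j else 0)"
      "(\<Sum>k\<in>UNIV. y $ i $ k * I $ k $ j) = (\<Sum>k\<in>UNIV. if k = j then y $ i $ k else 0)" for i j
      by (intro sum.cong; simp add: I_def)+
    then show ?thesis
      by (simp add: vec_eq_iff jordan_nth sum.distrib flip: scaleR_2)
  qed
  then have "T I = real (dim (Herm :: ('a^'n^'n) set))"
    by (simp add: T_def endo_trace_id)
  then have N: "real (dim (Herm :: ('a^'n^'n) set)) = t * real CARD('n)"
    using formula[OF I] by (simp add: I_def)
  then show "endo_trace Herm (\<lambda>y. z \<star> y) =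
      real (dim (Herm :: ('a^'n^'n) set)) / real CARD('n) * (\<Sum>i\<in>UNIV. re (z $ i $ i))"
    using formula[OF z] by (simp add: T_def)
  show "real (dim (Herm :: ('a^'n^'n) set)) \<noteq> 0"
  proof
    assume "real (dim (Herm :: ('a^'n^'n) set)) = 0"
    then have "card basis = 0"
      by (metis dim_eq_card independent_basis span_basis span_span of_nat_eq_0_iff)
    then have "span basis = {0}" using finite_basis by simp
    then have "I = 0" using I span_basis by blast
    then have "I $ i0 $ i0 = 0" by simp
    then show False by (simp add: I_def)
  qed
qed

lemma herm_metric_eq_trace_form:
  "x \<in> Herm \<Longrightarrow> y \<in> Herm \<Longrightarrow> herm_metric (x :: 'a^'n^'n) y = trace_form x y"
  using endo_trace_jordan(2)[of "x \<star> y"]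
  by (simp add: herm_metric_def trace_form_jordan endo_trace_jordan(1) jordan_Herm)

lemma mat_trace_jordan:
  assumes "x \<in> Herm" "y \<in> Herm"
  shows "trace_form (x :: 'a^'n^'n) y *\<^sub>R 1 = (1 / real CARD('n)) *\<^sub>R mat_trace (x \<star> y)"
proof -
  have "mat_trace (x \<star> y) = (\<Sum>i\<in>UNIV. re ((x \<star> y) $ i $ i) *\<^sub>R 1)"
    unfolding mat_trace_def by (intro sum.cong refl Herm_diagonal jordan_Herm assms)
  then show ?thesis
    by (simp add: trace_form_jordan flip: scaleR_sum_left)
qed

lemma metric_algebra_Herm: "metric_algebra (Herm :: ('a^'n^'n) set) (\<star>) trace_form"
proof (intro metric_algebra.intro metric_algebra_axioms.intro finite_dimensional_Herm)
  interpret finite_dimensional_subspace "Herm :: ('a^'n^'n) set"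
    by (rule finite_dimensional_Herm)
  fix \<phi> :: "'a^'n^'n \<Rightarrow> 'a^'n^'n" and x y :: "'a^'n^'n"
  assume \<phi>: "\<phi> \<in> alg_aut Herm (\<star>)" and xy: "x \<in> Herm" "y \<in> Herm"
  have "endo_trace Herm (\<lambda>z. (\<phi> x \<star> \<phi> y) \<star> z) = endo_trace Herm (\<lambda>z. (x \<star> y) \<star> z)"
    using alg_autD(3,4)[OF \<phi>] xy
    by (intro endo_trace_conjugate[OF alg_autD(1,2)[OF \<phi>]] linear_imp_lin_on linear_jordan
        jordan_Herm) (auto simp: jordan_Herm)
  then show "trace_form (\<phi> x) (\<phi> y) = trace_form x y"
    using xy alg_autD(3)[OF \<phi>] by (simp add: herm_metric_def flip: herm_metric_eq_trace_form)
qed (auto intro: linear_jordan jordan_Herm linear_trace_form trace_form_pos trace_form_commute)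

end

section \<open>Phase automorphisms and diagonalisation\<close>

context hurwitz
begin

text \<open>
  These are the products that arise when a Hermitian matrix of size three is conjugated by
  \<open>diag (bar a, 1, a)\<close>.
\<close>

lemma moufang_unit:
  assumes "nrm (a::'a) = 1"
  shows "(a * x) * (y * a) = a * ((x * y) * a)"
    and "(a * (x * a)) * (bar a * y) = a * (x * y)"
    and "(x * bar a) * (a * (y * a)) = (x * y) * a"
proof -
  show "(a * x) * (y * a) = a * ((x * y) * a)"
    by (simp add: moufang_middle flexible)
  show "(a * (x * a)) * (bar a * y) = a * (x * y)"
    using assms moufang_left[of a x "bar a * y"] by (simp add: cancel_left' flexible)
  show "(x * bar a) * (a * (y * a)) = (x * y) * a"
    using assms moufang_right[of "x * bar a" a y] by (simp add: cancel_right' flexible)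
qed

lemma diag_conj_diagonal:
  assumes "nrm (d r :: 'a) = 1" "x $ r $ r = re (x $ r $ r) *\<^sub>R 1"
  shows "diag_conj d x $ r $ r = x $ r $ r"
proof -
  have "d r * ((re (x $ r $ r) *\<^sub>R 1) * bar (d r)) = re (x $ r $ r) *\<^sub>R 1"
    by (simp add: mult_bar_self assms(1))
  then show ?thesis using assms(2) by (metis diag_conj_nth)
qed

lemma linear_diag_conj: "linear (diag_conj d :: 'a^'n^'n \<Rightarrow> 'a^'n^'n)"
  by (rule linearI) (simp_all add: vec_eq_iff)

text \<open>
  Conjugation by a diagonal matrix of units. Entry \<open>(r, s)\<close> of a Jordan product with \<open>r \<noteq> s\<close> is a
  sum of products over paths \<open>r, t, s\<close>; the hypothesis \<open>prod\<close> treats the paths with three distinct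
  vertices, and the others contain a diagonal, hence real, entry. The diagonal of a Jordan product
  consists of inner products of rows, which unit factors preserve.
\<close>

lemma diag_conj_aut:
  fixes d :: "'n::finite \<Rightarrow> 'a"
  assumes unit: "\<And>r. nrm (d r) = 1"
    and assoc: "\<And>r s a. r \<noteq> s \<Longrightarrow> (d r * a) * bar (d s) = d r * (a * bar (d s))"
    and prod: "\<And>r t s a b. r \<noteq> t \<Longrightarrow> t \<noteq> s \<Longrightarrow> r \<noteq> s \<Longrightarrow>
      (d r * (a * bar (d t))) * (d t * (b * bar (d s))) = d r * ((a * b) * bar (d s))"
  shows "diag_conj d \<in> alg_aut (Herm :: ('a^'n^'n) set) (\<star>)"
proof -
  have assoc': "(bar (d r) * a) * d s = bar (d r) * (a * d s)" if "r \<noteq> s" for r s a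
    using assoc[OF that, of a] by (simp add: bar_eq[of "d r"] bar_eq[of "d s"])
  have off: "diag_conj d x \<in> Herm" if x: "x \<in> Herm" for x :: "'a^'n^'n"
  proof -
    have "bar (diag_conj d x $ s $ r) = diag_conj d x $ r $ s" for r s
    proof (cases "r = s")
      case True
      then show ?thesis
        using diag_conj_diagonal[OF unit Herm_diagonal[OF x]] x by (simp add: mem_Herm del: diag_conj_nth)
    next
      case False
      then show ?thesis using x assoc by (simp add: mem_Herm)
    qed
    then show ?thesis by (simp add: mem_Herm)
  qed
  define \<psi> where "\<psi> x = (\<chi> r s. bar (d r) * (x $ r $ s * d s))" for x :: "'a^'n^'n"
  have \<psi>_conj: "\<psi> x = diag_conj (\<lambda>r. bar (d r)) x" for x
    by (simp add: \<psi>_def vec_eq_iff)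
  have \<psi>_diag: "\<psi> x $ r $ r = x $ r $ r" if "x \<in> Herm" for x r
    unfolding \<psi>_conj by (rule diag_conj_diagonal) (simp_all add: unit Herm_diagonal[OF that, symmetric])
  have \<psi>_Herm: "\<psi> x \<in> Herm" if x: "x \<in> Herm" for x
  proof -
    have "bar (\<psi> x $ s $ r) = \<psi> x $ r $ s" for r s
    proof (cases "r = s")
      case True
      then show ?thesis using \<psi>_diag[OF x] x by (simp add: mem_Herm)
    next
      case False
      then show ?thesis using x assoc' by (simp add: mem_Herm \<psi>_def)
    qed
    then show ?thesis by (simp add: mem_Herm)
  qed
  show ?thesis
  proof (rule alg_autI[where \<psi> = \<psi>])
    fix x :: "'a^'n^'n" assume x: "x \<in> Herm"
    have "\<psi> (diag_conj d x) $ r $ s = x $ r $ s" for r s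
    proof (cases "r = s")
      case True
      then show ?thesis
        using \<psi>_diag[OF off[OF x]] diag_conj_diagonal[OF unit Herm_diagonal[OF x]] by simp
    next
      case False
      then show ?thesis
        by (simp add: \<psi>_def assoc[symmetric] cancel_right' cancel_left unit)
    qed
    then show "\<psi> (diag_conj d x) = x" by (simp add: vec_eq_iff)
    have "diag_conj d (\<psi> x) $ r $ s = x $ r $ s" for r s
    proof (cases "r = s")
      case True
      then show ?thesis
        using \<psi>_diag[OF x] diag_conj_diagonal[OF unit Herm_diagonal[OF \<psi>_Herm[OF x]]] by simp
    next
      case False
      then show ?thesis
        by (simp add: \<psi>_def assoc'[symmetric] cancel_right cancel_left' unit)
    qed
    then show "diag_conj d (\<psi> x) = x" by (simp add: vec_eq_iff)
    fix y :: "'a^'n^'n" assume y: "y \<in> Herm"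
    have off_diag: "diag_conj d x $ r $ t * diag_conj d y $ t $ s = d r * ((x $ r $ t * y $ t $ s) * bar (d s))"
      if "r \<noteq> s" and x: "x \<in> Herm" and y: "y \<in> Herm" for x y r s t
    proof -
      consider "t = r" | "t = s" | "r \<noteq> t" "t \<noteq> s" by blast
      then show ?thesis
      proof cases
        case 1
        obtain \<alpha> where \<alpha>: "x $ r $ r = \<alpha> *\<^sub>R 1" using Herm_diagonal[OF x] by blast
        have "diag_conj d x $ r $ r = \<alpha> *\<^sub>R 1"
          by (simp add: \<alpha> mult_bar_self unit)
        then show ?thesis unfolding 1 by (simp only:) (simp add: \<alpha>)
      next
        case 2
        obtain \<alpha> where \<alpha>: "y $ s $ s = \<alpha> *\<^sub>R 1" using Herm_diagonal[OF y] by blast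
        have "diag_conj d y $ s $ s = \<alpha> *\<^sub>R 1"
          by (simp add: \<alpha> mult_bar_self unit)
        then show ?thesis unfolding 2 by (simp only:) (simp add: \<alpha>)
      next
        case 3
        then show ?thesis using prod[OF 3 that(1)] by simp
      qed
    qed
    have "diag_conj d (x \<star> y) $ r $ s = (diag_conj d x \<star> diag_conj d y) $ r $ s" for r s
    proof (cases "r = s")
      case True
      have diag: "(x \<star> y) $ r $ r = (\<Sum>k\<in>UNIV. re (x $ r $ k * bar (y $ r $ k))) *\<^sub>R 1"
        if "x \<in> Herm" "y \<in> Herm" for x y :: "'a^'n^'n"
      proof -
        have "x $ r $ k * y $ k $ r + y $ r $ k * x $ k $ r =
            (2 * re (x $ r $ k * bar (y $ r $ k))) *\<^sub>R 1" for k
          using that add_bar[of "x $ r $ k * bar (y $ r $ k)"] by (simp add: mem_Herm)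
        then show ?thesis
          by (simp add: jordan_nth scaleR_sum_left[symmetric] sum_distrib_left[symmetric])
      qed
      have iso: "re ((d r * (a * bar (d k))) * bar (d r * (b * bar (d k)))) = re (a * bar b)" for k a b
        unfolding re_mult_isometry_left re_mult_isometry_right by (simp add: unit)
      have "(diag_conj d x \<star> diag_conj d y) $ r $ r = (x \<star> y) $ r $ r"
        unfolding diag[OF x y] diag[OF off[OF x] off[OF y]] diag_conj_nth iso ..
      then show ?thesis
        using True diag_conj_diagonal[OF unit Herm_diagonal[OF jordan_Herm[OF x y]]] by simp
    next
      case False
      have "diag_conj d (x \<star> y) $ r $ s = (1 / 2) *\<^sub>R (\<Sum>k\<in>UNIV.
          d r * ((x $ r $ k * y $ k $ s) * bar (d s)) + d r * ((y $ r $ k * x $ k $ s) * bar (d s)))"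
        by (simp add: jordan_nth star_sum_left star_sum_right)
      then show ?thesis
        unfolding jordan_nth[of "diag_conj d x"] off_diag[OF False x y] off_diag[OF False y x] .
    qed
    then show "diag_conj d (x \<star> y) = diag_conj d x \<star> diag_conj d y" by (simp add: vec_eq_iff)
  qed (auto intro: linear_diag_conj off \<psi>_Herm)
qed

text \<open>
  Over an associative algebra a single unit entry suffices. For \<open>n = 3\<close> the diagonal is
  \<open>(bar a, 1, a)\<close>, with the third coordinate chosen to match the Moufang identities.
\<close>

lemma phase_aut:
  assumes dich: "(\<forall>a b c::'a. (a * b) * c = a * (b * c)) \<or> CARD('n) = 3"
    and ij: "i \<noteq> j" and q: "(q::'a) \<noteq> 0"
  shows "\<exists>d. diag_conj d \<in> alg_aut (Herm :: ('a^'n^'n) set) (\<star>) \<and> (\<forall>r. nrm (d r) = 1) \<and>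
    d i * (q * bar (d j)) = sqrt (nrm q) *\<^sub>R 1"
proof -
  define s where "s = sqrt (nrm q)"
  have s: "s > 0" "s * s = nrm q"
    using nrm_pos[OF q] by (simp_all add: s_def)
  define a where "a = (1 / s) *\<^sub>R q"
  have a: "nrm a = 1"
    using s by (simp add: a_def power2_eq_square flip: s(2))
  have aq: "bar a * q = s *\<^sub>R 1"
    using s by (simp add: a_def bar_mult_self field_simps)
  show ?thesis
  proof (cases "\<forall>a b c::'a. (a * b) * c = a * (b * c)")
    case True
    define d where "d r = (if r = i then bar a else 1)" for r
    have unit: "nrm (d r) = 1" for r
      by (simp add: d_def a)
    have "diag_conj d \<in> alg_aut (Herm :: ('a^'n^'n) set) (\<star>)"
    proof (rule diag_conj_aut)
      show "(d r * (x * bar (d t))) * (d t * (y * bar (d s))) = d r * ((x * y) * bar (d s))"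
        for r t s x y
      proof -
        have "bar (d t) * (d t * z) = z" for z
          using cancel_left[of "d t" z] unit by simp
        then show ?thesis using True by simp
      qed
    qed (use True unit in auto)
    moreover have "d i * (q * bar (d j)) = s *\<^sub>R 1"
      using ij aq by (simp add: d_def)
    ultimately show ?thesis using unit s_def by blast
  next
    case False
    then have "CARD('n) = 3"
      using dich by blast
    then have "card (UNIV - {i, j}) = 1"
      using ij by (simp add: card_Diff_subset)
    then obtain k where "UNIV - {i, j} = {k}"
      using card_1_singletonE by blast
    then have k: "k \<noteq> i" "k \<noteq> j" and UNIV: "r = i \<or> r = j \<or> r = k" for r
      by auto
    define d where "d r = (if r = i then bar a else if r = j then 1 else a)" for r
    have d [simp]: "d i = bar a" "d j = 1" "d k = a"
      using ij k by (auto simp: d_def)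
    have unit: "nrm (d r) = 1" for r
      by (simp add: d_def a)
    have "diag_conj d \<in> alg_aut (Herm :: ('a^'n^'n) set) (\<star>)"
    proof (rule diag_conj_aut[OF unit])
      show "(d r * x) * bar (d s) = d r * (x * bar (d s))" if "r \<noteq> s" for r s x
        using that UNIV[of r] UNIV[of s] by (auto simp: flexible)
      have bar_a: "nrm (bar a) = 1" using a by simp
      note M = moufang_unit[OF a] moufang_unit[OF bar_a, unfolded bar_bar]
      show "(d r * (x * bar (d t))) * (d t * (y * bar (d s))) = d r * ((x * y) * bar (d s))"
        if "r \<noteq> t" "t \<noteq> s" "r \<noteq> s" for r t s x y
        using that UNIV[of r] UNIV[of s] UNIV[of t] by (auto simp: M)
    qed
    moreover have "d i * (q * bar (d j)) = s *\<^sub>R 1"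
      using aq by simp
    ultimately show ?thesis using unit s_def by blast
  qed
qed

text \<open>
  Once the entry \<open>(i, j)\<close> is a real number \<open>r\<close>, the block of the rows and columns \<open>i, j\<close> is a real
  symmetric matrix. Diagonalising it by a plane reflection adds \<open>2 * r\<^sup>2\<close> to the sum of squares of the
  diagonal and changes no other diagonal entry.
\<close>

lemma jacobi_step:
  assumes dich: "(\<forall>a b c::'a. (a * b) * c = a * (b * c)) \<or> CARD('n) = 3"
    and x: "(x :: 'a^'n^'n) \<in> Herm" and ij: "i \<noteq> j" "x $ i $ j \<noteq> 0"
  shows "\<exists>\<phi>\<in>alg_aut Herm (\<star>).
    (\<Sum>k\<in>UNIV. (re (x $ k $ k))\<^sup>2) < (\<Sum>k\<in>UNIV. (re (\<phi> x $ k $ k))\<^sup>2)"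
proof -
  define r where "r = sqrt (nrm (x $ i $ j))"
  have r: "r > 0" using nrm_pos[OF ij(2)] by (simp add: r_def)
  obtain d where d: "diag_conj d \<in> alg_aut (Herm :: ('a^'n^'n) set) (\<star>)" "\<And>r. nrm (d r) = 1"
    "d i * (x $ i $ j * bar (d j)) = r *\<^sub>R 1"
    using phase_aut[OF dich ij] unfolding r_def by blast
  define y where "y = diag_conj d x"
  have y: "y \<in> Herm" using alg_autD(3)[OF d(1) x] by (simp add: y_def)
  have y_diag: "y $ k $ k = x $ k $ k" for k
    unfolding y_def by (rule diag_conj_diagonal[OF d(2) Herm_diagonal[OF x]])
  have y_ij: "y $ i $ j = r *\<^sub>R 1"
    using d(3) by (simp add: y_def)
  have y_ji: "y $ j $ i = r *\<^sub>R 1"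
    using y y_ij unfolding mem_Herm by (metis bar_one bar_scaleR)
  define \<alpha> \<beta> where "\<alpha> = re (y $ i $ i)" "\<beta> = re (y $ j $ j)"
  \<comment> \<open>The reflection doubles the angle of its normal and conjugation doubles it again, so the normal
    has a quarter of the argument of z.\<close>
  define z where "z = Complex (\<alpha> - \<beta>) (2 * r)"
  define w where "w k = (if k = i then cos (Arg z / 4) else if k = j then sin (Arg z / 4) else 0)" for k
  define C S where "C = cos (Arg z / 2)" "S = sin (Arg z / 2)"
  have w: "\<forall>k. k \<noteq> i \<and> k \<noteq> j \<longrightarrow> w k = 0" by (simp add: w_def)
  have w_ij: "w i = cos (Arg z / 4)" "w j = sin (Arg z / 4)" using ij by (simp_all add: w_def)
  have CS: "C = 1 - 2 * (w j)\<^sup>2" "C = 2 * (w i)\<^sup>2 - 1" "S = 2 * w i * w j"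
    using cos_double_sin[of "Arg z / 4"] cos_double_cos[of "Arg z / 4"] sin_double[of "Arg z / 4"]
    by (simp_all add: C_S_def w_ij)
  have CS1: "C\<^sup>2 + S\<^sup>2 = 1" by (simp add: C_S_def)
  have polar: "(C\<^sup>2 - S\<^sup>2) * (\<alpha> - \<beta>) + 4 * C * S * r = cmod z"
  proof -
    have 1: "\<alpha> - \<beta> = cmod z * cos (Arg z)" "2 * r = cmod z * sin (Arg z)"
      using rcis_cmod_Arg[of z] by (metis Re_rcis z_def complex.sel(1), metis Im_rcis z_def complex.sel(2))
    have 2: "C\<^sup>2 - S\<^sup>2 = cos (Arg z)" "2 * C * S = sin (Arg z)"
      using cos_double[of "Arg z / 2"] sin_double[of "Arg z / 2"] by (simp_all add: C_S_def)
    have "(C\<^sup>2 - S\<^sup>2) * (\<alpha> - \<beta>) + 4 * C * S * r = cos (Arg z) * (\<alpha> - \<beta>) + sin (Arg z) * (2 * r)"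
      using 2 by (simp add: algebra_simps)
    also have "\<dots> = cmod z * ((cos (Arg z))\<^sup>2 + (sin (Arg z))\<^sup>2)"
      unfolding 1 by algebra
    finally show ?thesis by simp
  qed
  have "(\<Sum>k\<in>UNIV. (w k)\<^sup>2) = (w i)\<^sup>2 + (w j)\<^sup>2"
    by (rule sum_two_points) (use ij w in auto)
  then have aut: "reflect w \<in> alg_aut (Herm :: ('a^'n^'n) set) (\<star>)"
    by (intro reflect_aut) (simp add: w_ij)
  let ?z = "reflect w y"
  note entries = reflect_def plane_reflection_nth[OF ij(1) w]
  have "re (?z $ i $ i) = C\<^sup>2 * \<alpha> + 2 * C * S * r + S\<^sup>2 * \<beta>"
  proof -
    have "re (?z $ i $ i) = (1 - 2 * (w i)\<^sup>2)\<^sup>2 * \<alpha> - 2 * (1 - 2 * (w i)\<^sup>2) * (2 * w i * w j) * r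
        + (2 * w i * w j)\<^sup>2 * \<beta>"
      unfolding entries by (simp add: y_ij y_ji flip: \<alpha>_\<beta>_def) (simp add: algebra_simps power2_eq_square)
    also have "1 - 2 * (w i)\<^sup>2 = - C" using CS(2) by simp
    finally show ?thesis unfolding CS(3) by simp
  qed
  moreover have "re (?z $ j $ j) = S\<^sup>2 * \<alpha> - 2 * C * S * r + C\<^sup>2 * \<beta>"
  proof -
    have "re (?z $ j $ j) = (2 * w i * w j)\<^sup>2 * \<alpha> - 2 * (1 - 2 * (w j)\<^sup>2) * (2 * w i * w j) * r
        + (1 - 2 * (w j)\<^sup>2)\<^sup>2 * \<beta>"
      unfolding entries by (simp add: y_ij y_ji flip: \<alpha>_\<beta>_def) (simp add: algebra_simps power2_eq_square)
    then show ?thesis unfolding CS(1)[symmetric] CS(3) by simp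
  qed
  ultimately have sum_eq: "re (?z $ i $ i) + re (?z $ j $ j) = \<alpha> + \<beta>"
    and diff_eq: "re (?z $ i $ i) - re (?z $ j $ j) = cmod z"
    using arg_cong[OF CS1, of "\<lambda>t. t * (\<alpha> + \<beta>)"] polar by (simp_all add: algebra_simps)
  have parallelogram: "2 * (p\<^sup>2 + q\<^sup>2) = (p + q)\<^sup>2 + (p - q)\<^sup>2" for p q :: real
    by (simp add: power2_eq_square algebra_simps)
  have "(cmod z)\<^sup>2 = (\<alpha> - \<beta>)\<^sup>2 + 4 * r\<^sup>2"
    by (simp add: z_def cmod_power2 power_mult_distrib)
  then have "2 * ((re (?z $ i $ i))\<^sup>2 + (re (?z $ j $ j))\<^sup>2) = 2 * (\<alpha>\<^sup>2 + \<beta>\<^sup>2) + 4 * r\<^sup>2"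
    unfolding parallelogram[of "re (?z $ i $ i)"] parallelogram[of \<alpha>] sum_eq diff_eq by simp
  then have grow: "\<alpha>\<^sup>2 + \<beta>\<^sup>2 < (re (?z $ i $ i))\<^sup>2 + (re (?z $ j $ j))\<^sup>2"
    using r by (smt (verit) zero_less_power)
  have same: "?z $ k $ k = y $ k $ k" if "k \<noteq> i" "k \<noteq> j" for k
    unfolding entries using that w by simp
  have "(\<Sum>k\<in>UNIV. (re (?z $ k $ k))\<^sup>2 - (re (y $ k $ k))\<^sup>2) =
      ((re (?z $ i $ i))\<^sup>2 - \<alpha>\<^sup>2) + ((re (?z $ j $ j))\<^sup>2 - \<beta>\<^sup>2)"
    unfolding \<alpha>_\<beta>_def by (rule sum_two_points) (use ij same in auto)
  then have "(\<Sum>k\<in>UNIV. (re (y $ k $ k))\<^sup>2) < (\<Sum>k\<in>UNIV. (re (?z $ k $ k))\<^sup>2)"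
    using grow by (simp add: sum_subtractf)
  then show ?thesis
    using alg_aut_compose[OF d(1) aut] unfolding y_diag by (auto simp: y_def)
qed

lemma diagonalise:
  assumes dich: "(\<forall>a b c::'a. (a * b) * c = a * (b * c)) \<or> CARD('n) = 3"
    and x: "(x :: 'a^'n^'n) \<in> Herm"
  shows "\<exists>\<phi>\<in>alg_aut Herm (\<star>). \<forall>i j. i \<noteq> j \<longrightarrow> \<phi> x $ i $ j = 0"
proof -
  interpret metric_algebra "Herm :: ('a^'n^'n) set" "(\<star>)" trace_form
    by (rule metric_algebra_Herm)
  let ?D = "range (\<lambda>k. entry k k 1) :: ('a^'n^'n) set"
  have D: "finite ?D" "?D \<subseteq> Herm"
    by (auto simp: mem_Herm entry_def)
  have inj: "inj (\<lambda>k. entry k k 1 :: 'a^'n^'n)"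
  proof (rule injI)
    fix k l assume "(entry k k 1 :: 'a^'n^'n) = entry l l 1"
    then have "(entry k k 1 :: 'a^'n^'n) $ k $ k = entry l l 1 $ k $ k" by simp
    then show "k = l" by (auto simp: entry_def split: if_splits)
  qed
  have tf: "trace_form y (entry k k 1) = re (y $ k $ k) / real CARD('n)" for y :: "'a^'n^'n" and k
  proof -
    have "re (y $ i $ j * entry k k 1 $ j $ i) =
        (if j = k then if i = k then re (y $ k $ k) else 0 else 0)" for i j
      by (simp add: entry_def)
    then show ?thesis by (simp add: trace_form_def)
  qed
  have D_sum: "(\<Sum>e\<in>?D. (trace_form y e)\<^sup>2) = (\<Sum>k\<in>UNIV. (re (y $ k $ k))\<^sup>2) / (real CARD('n))\<^sup>2"
    for y :: "'a^'n^'n"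
    by (simp add: sum.reindex[OF inj] tf power_divide sum_divide_distrib)
  obtain \<phi> where \<phi>: "\<phi> \<in> alg_aut Herm (\<star>)" and max: "\<And>\<psi>. \<psi> \<in> alg_aut Herm (\<star>) \<Longrightarrow>
      (\<Sum>k\<in>UNIV. (re (\<psi> x $ k $ k))\<^sup>2) \<le> (\<Sum>k\<in>UNIV. (re (\<phi> x $ k $ k))\<^sup>2)"
    using aut_orbit_maximiser[OF x D] by (auto simp: D_sum divide_le_cancel)
  have "\<phi> x $ i $ j = 0" if ij: "i \<noteq> j" for i j
  proof (rule ccontr)
    assume "\<phi> x $ i $ j \<noteq> 0"
    then obtain \<psi> where \<psi>: "\<psi> \<in> alg_aut Herm (\<star>)"
      "(\<Sum>k\<in>UNIV. (re (\<phi> x $ k $ k))\<^sup>2) < (\<Sum>k\<in>UNIV. (re (\<psi> (\<phi> x) $ k $ k))\<^sup>2)"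
      using jacobi_step[OF dich alg_autD(3)[OF \<phi> x] ij] by blast
    then show False
      using max[OF alg_aut_compose[OF \<phi> \<psi>(1)]] by simp
  qed
  then show ?thesis using \<phi> by blast
qed

end

section \<open>The eigenvalue inequality and planes in a metric algebra\<close>

text \<open>
  The gap between \<open>2 |a|\<^sup>2\<close> and \<open>(a i - a j)\<^sup>2\<close> is a sum of squares, so both the estimate and its
  equality case can be read off.
\<close>

lemma off_diagonal_gap:
  fixes a :: "'n::finite \<Rightarrow> real"
  assumes "i \<noteq> j"
  shows "(a i - a j)\<^sup>2 + (a i + a j)\<^sup>2 + 2 * (\<Sum>k\<in>UNIV - {i, j}. (a k)\<^sup>2) = 2 * (\<Sum>k\<in>UNIV. (a k)\<^sup>2)"
proof -
  have "(\<Sum>k\<in>UNIV. (a k)\<^sup>2) = (\<Sum>k\<in>UNIV - {i, j}. (a k)\<^sup>2) + (\<Sum>k\<in>{i, j}. (a k)\<^sup>2)"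
    by (rule sum.subset_diff) auto
  then show ?thesis
    using assms by (simp add: power2_eq_square algebra_simps)
qed

context
  fixes a d :: "'n::finite \<Rightarrow> real" and Y :: "'n \<Rightarrow> 'n \<Rightarrow> real"
  assumes Y_nonneg: "\<And>i j. 0 \<le> Y i j" and Y_diag: "\<And>i. Y i i = (d i)\<^sup>2"
begin

abbreviation "norm_a \<equiv> \<Sum>i\<in>UNIV. (a i)\<^sup>2"

abbreviation "inner_ad \<equiv> \<Sum>i\<in>UNIV. a i * d i"

definition "slack i j = (if i = j then 0 else (norm_a - (a i - a j)\<^sup>2 / 2) * Y i j)"

lemma slack_nonneg: "0 \<le> slack i j"
proof (cases "i = j")
  case False
  have "0 \<le> (\<Sum>k\<in>UNIV - {i, j}. (a k)\<^sup>2)" by (simp add: sum_nonneg)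
  then have "(a i - a j)\<^sup>2 / 2 \<le> norm_a"
    using off_diagonal_gap[OF False, of a] zero_le_power2[of "a i + a j"] by linarith
  then show ?thesis
    using Y_nonneg[of i j] False by (simp only: slack_def if_False) (rule mult_nonneg_nonneg, simp_all)
qed (simp add: slack_def)

text \<open>
  The difference of the two sides of the inequality, split into the off-diagonal losses and the
  Cauchy--Schwarz defect of the diagonal, both nonnegative.
\<close>

lemma slack_identity:
  "norm_a * (\<Sum>i\<in>UNIV. \<Sum>j\<in>UNIV. Y i j) - inner_ad\<^sup>2 - (1 / 2) * (\<Sum>i\<in>UNIV. \<Sum>j\<in>UNIV. (a i - a j)\<^sup>2 * Y i j)
    = (\<Sum>i\<in>UNIV. \<Sum>j\<in>UNIV. slack i j) + (norm_a * (\<Sum>i\<in>UNIV. (d i)\<^sup>2) - inner_ad\<^sup>2)"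
proof -
  have "norm_a * Y i j - (1 / 2) * ((a i - a j)\<^sup>2 * Y i j)
      = slack i j + (if j = i then norm_a * (d i)\<^sup>2 else 0)" for i j
    by (auto simp: slack_def Y_diag algebra_simps)
  then have "(\<Sum>i\<in>UNIV. \<Sum>j\<in>UNIV. norm_a * Y i j - (1 / 2) * ((a i - a j)\<^sup>2 * Y i j)) =
      (\<Sum>i\<in>UNIV. \<Sum>j\<in>UNIV. slack i j) + (\<Sum>i\<in>UNIV. norm_a * (d i)\<^sup>2)"
    by (simp add: sum.distrib)
  then show ?thesis
    by (simp add: sum_subtractf sum_distrib_left)
qed

lemma cauchy_schwarz_ad: "inner_ad\<^sup>2 \<le> norm_a * (\<Sum>i\<in>UNIV. (d i)\<^sup>2)"
  by (rule Cauchy_Schwarz_ineq_sum)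

lemma commutator_bound:
  "(1 / 2) * (\<Sum>i\<in>UNIV. \<Sum>j\<in>UNIV. (a i - a j)\<^sup>2 * Y i j) \<le>
    norm_a * (\<Sum>i\<in>UNIV. \<Sum>j\<in>UNIV. Y i j) - inner_ad\<^sup>2"
proof -
  have "0 \<le> (\<Sum>i\<in>UNIV. \<Sum>j\<in>UNIV. slack i j)"
    by (intro sum_nonneg slack_nonneg)
  then show ?thesis
    using slack_identity cauchy_schwarz_ad by linarith
qed

lemma commutator_bound_equality:
  assumes eq: "(1 / 2) * (\<Sum>i\<in>UNIV. \<Sum>j\<in>UNIV. (a i - a j)\<^sup>2 * Y i j) =
      norm_a * (\<Sum>i\<in>UNIV. \<Sum>j\<in>UNIV. Y i j) - inner_ad\<^sup>2"
    and a: "norm_a \<noteq> 0"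
  shows "i \<noteq> j \<Longrightarrow> Y i j \<noteq> 0 \<Longrightarrow> (a i - a j)\<^sup>2 = 2 * norm_a"
    and "\<exists>c. \<forall>i. d i = c * a i"
proof -
  have nonneg: "0 \<le> (\<Sum>i\<in>UNIV. \<Sum>j\<in>UNIV. slack i j)"
    by (intro sum_nonneg slack_nonneg)
  then have slack: "(\<Sum>i\<in>UNIV. \<Sum>j\<in>UNIV. slack i j) = 0"
    and cs: "inner_ad\<^sup>2 = norm_a * (\<Sum>i\<in>UNIV. (d i)\<^sup>2)"
    using slack_identity cauchy_schwarz_ad eq by linarith+
  have "slack i j = 0"
    using slack by (simp add: sum_nonneg_eq_0_iff sum_nonneg slack_nonneg)
  then show "(a i - a j)\<^sup>2 = 2 * norm_a" if "i \<noteq> j" "Y i j \<noteq> 0"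
    using that by (auto simp: slack_def)
  \<comment> \<open>The Fourier coefficient of d along a; the residual d - c a has norm zero.\<close>
  define c where "c = inner_ad / norm_a"
  have "(\<Sum>i\<in>UNIV. (d i - c * a i)\<^sup>2) =
      (\<Sum>i\<in>UNIV. (d i)\<^sup>2) - 2 * c * inner_ad + c\<^sup>2 * norm_a"
    by (simp add: power2_diff sum.distrib sum_subtractf sum_distrib_left power_mult_distrib mult_ac)
  also have "\<dots> = 0"
  proof -
    have "norm_a * ((\<Sum>i\<in>UNIV. (d i)\<^sup>2) - 2 * c * inner_ad + c\<^sup>2 * norm_a) =
        norm_a * (\<Sum>i\<in>UNIV. (d i)\<^sup>2) - 2 * (c * norm_a) * inner_ad + (c * norm_a)\<^sup>2"
      by (simp add: algebra_simps power2_eq_square)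
    also have "c * norm_a = inner_ad" using a by (simp add: c_def)
    also have "norm_a * (\<Sum>i\<in>UNIV. (d i)\<^sup>2) - 2 * inner_ad * inner_ad + inner_ad\<^sup>2 = 0"
      using cs by (simp add: power2_eq_square)
    finally show ?thesis using a by (simp only: mult_eq_0_iff) simp
  qed
  finally have "\<forall>i. d i - c * a i = 0"
    by (simp add: sum_nonneg_eq_0_iff)
  then show "\<exists>c. \<forall>i. d i = c * a i" by (intro exI[of _ c]) simp
qed

end

lemma span_pair: "span {x, y} = {\<alpha> *\<^sub>R x + \<beta> *\<^sub>R y |\<alpha> \<beta>. True}" for x y :: "'v::real_vector"
proof -
  have "z \<in> span {x, y} \<longleftrightarrow> (\<exists>\<alpha> \<beta>. z = \<alpha> *\<^sub>R x + \<beta> *\<^sub>R y)" for z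
    by (simp add: span_breakdown_eq span_singleton image_iff diff_eq_eq add.commute)
  then show ?thesis by blast
qed

lemma independent_pair_not_multiple:
  assumes "x \<noteq> y" "independent {x, y}"
  shows "x \<noteq> 0" "y \<noteq> c *\<^sub>R (x :: 'v::real_vector)"
proof -
  show "x \<noteq> 0" using assms(2) dependent_zero by blast
  show "y \<noteq> c *\<^sub>R x"
    using assms by (auto simp: insert_commute[of x] independent_insert span_singleton)
qed

lemma alg_aut_span_pair:
  assumes "subspace V" "\<phi> \<in> alg_aut V m" "x \<in> V" "y \<in> V"
  shows "\<phi> ` span {x, y} = span {\<phi> x, \<phi> y}"
proof -
  have "\<phi> (\<alpha> *\<^sub>R x + \<beta> *\<^sub>R y) = \<alpha> *\<^sub>R \<phi> x + \<beta> *\<^sub>R \<phi> y" for \<alpha> \<beta>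
    using alg_autD(5,6)[OF assms(2)] assms(1,3,4) by (simp add: subspace_scale)
  then show ?thesis
    unfolding span_pair by (auto simp: image_iff) metis+
qed

context metric_algebra
begin

abbreviation gram :: "'v \<Rightarrow> 'v \<Rightarrow> real"
  where "gram x y \<equiv> h x x * h y y - (h x y)\<^sup>2"

lemma gram_pos:
  assumes "x \<in> V" "y \<in> V" "x \<noteq> y" "independent {x, y}"
  shows "gram x y > 0"
proof -
  note xy = independent_pair_not_multiple[OF assms(3,4)]
  have hx: "h x x > 0" using h_pos assms(1) xy(1) by blast
  define c where "c = h x y / h x x"
  have "y - c *\<^sub>R x \<in> V" "y - c *\<^sub>R x \<noteq> 0"
    using assms(1,2) V xy(2) by (auto intro: subspace_diff subspace_scale)
  then have "0 < h x x * h (y - c *\<^sub>R x) (y - c *\<^sub>R x)"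
    using hx h_pos by simp
  also have "\<dots> = h x x * h y y - 2 * (c * h x x) * h x y + (c * h x x)\<^sup>2"
    by (simp add: h_simps h_commute[of y x] algebra_simps power2_eq_square)
  also have "c * h x x = h x y" using hx by (simp add: c_def)
  finally show ?thesis by (simp add: power2_eq_square)
qed

lemma gram_change_of_basis:
  "gram (\<alpha> *\<^sub>R x + \<beta> *\<^sub>R y) (\<gamma> *\<^sub>R x + \<delta> *\<^sub>R y) = (\<alpha> * \<delta> - \<beta> * \<gamma>)\<^sup>2 * gram x y"
  by (simp add: h_simps h_commute[of y x]) algebra

text \<open>
  Commutativity gives the numerator the symmetries of a curvature tensor, so a change of basis multiplies
  it, like the Gram determinant, by the squared determinant.
\<close>

lemma sectional_nonassoc_change_of_basis:
  assumes m_commute: "\<And>x y. m x y = m y x" and "\<alpha> * \<delta> - \<beta> * \<gamma> \<noteq> 0"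
  shows "sectional_nonassoc m h (\<alpha> *\<^sub>R x + \<beta> *\<^sub>R y) (\<gamma> *\<^sub>R x + \<delta> *\<^sub>R y) = sectional_nonassoc m h x y"
proof -
  let ?x = "\<alpha> *\<^sub>R x + \<beta> *\<^sub>R y" and ?y = "\<gamma> *\<^sub>R x + \<delta> *\<^sub>R y"
  have expand: "m (p *\<^sub>R x + q *\<^sub>R y) (r *\<^sub>R x + s *\<^sub>R y) =
      (p * r) *\<^sub>R m x x + (p * s + q * r) *\<^sub>R m x y + (q * s) *\<^sub>R m y y" for p q r s
    by (simp add: linear_add[OF linear_m(1)] linear_scale[OF linear_m(1)] linear_add[OF linear_m(2)]
        linear_scale[OF linear_m(2)] m_commute[of y x] algebra_simps)
  have "h (m ?x ?x) (m ?y ?y) - h (m ?x ?y) (m ?y ?x) =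
      (\<alpha> * \<delta> - \<beta> * \<gamma>)\<^sup>2 * (h (m x x) (m y y) - h (m x y) (m y x))"
    unfolding expand m_commute[of y x] h_simps
      h_commute[of "m x y" "m x x"] h_commute[of "m y y" "m x x"] h_commute[of "m y y" "m x y"]
      real_scaleR_def
    by algebra
  then show ?thesis
    using assms(2) unfolding sectional_nonassoc_def gram_change_of_basis
    by (simp only: mult_divide_mult_cancel_left power_eq_0_iff simp_thms)
qed

lemma sectional_nonassoc_aut:
  assumes "\<phi> \<in> alg_aut V m" "x \<in> V" "y \<in> V"
  shows "sectional_nonassoc m h (\<phi> x) (\<phi> y) = sectional_nonassoc m h x y"
    and "gram (\<phi> x) (\<phi> y) = gram x y"
proof -
  have "h (m (\<phi> a) (\<phi> b)) (m (\<phi> c) (\<phi> d)) = h (m a b) (m c d)"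
    if "a \<in> V" "b \<in> V" "c \<in> V" "d \<in> V" for a b c d
    using that aut_isometry[OF assms(1)] by (simp add: m_closed flip: alg_autD(4)[OF assms(1)])
  then show "sectional_nonassoc m h (\<phi> x) (\<phi> y) = sectional_nonassoc m h x y"
    "gram (\<phi> x) (\<phi> y) = gram x y"
    using assms(2,3) aut_isometry[OF assms(1)] by (simp_all add: sectional_nonassoc_def)
qed

end

section \<open>Sectional nonassociativity of Hermitian matrices\<close>

context hurwitz
begin

definition diagonal_with :: "('n \<Rightarrow> real) \<Rightarrow> 'a^'n^'n \<Rightarrow> bool"
  where "diagonal_with a x \<longleftrightarrow> (\<forall>i j. x $ i $ j = (if i = j then a i *\<^sub>R 1 else 0))"

lemma diagonal_with_Herm: "diagonal_with a x \<Longrightarrow> x \<in> Herm"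
  by (simp add: mem_Herm diagonal_with_def)

lemma diagonal_jordan:
  assumes "diagonal_with a (x :: 'a^'n^'n)"
  shows "(x \<star> y) $ i $ j = ((a i + a j) / 2) *\<^sub>R y $ i $ j"
proof -
  have "x $ i $ k * y $ k $ j = (if i = k then a i *\<^sub>R y $ i $ j else 0)"
    "y $ i $ k * x $ k $ j = (if k = j then a j *\<^sub>R y $ i $ j else 0)" for k
    using assms by (simp_all add: diagonal_with_def)
  then show ?thesis
    by (simp add: jordan_nth sum.distrib scaleR_add_left add_divide_distrib scaleR_add_right)
qed

lemma diagonal_numerator:
  assumes x: "diagonal_with a (x :: 'a^'n^'n)" and y: "y \<in> Herm"
  shows "trace_form (x \<star> x) (y \<star> y) - trace_form (x \<star> y) (y \<star> x) =
    (\<Sum>i\<in>UNIV. \<Sum>j\<in>UNIV. (a i - a j)\<^sup>2 * nrm (y $ i $ j)) / (4 * real CARD('n))"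
proof -
  have "diagonal_with (\<lambda>i. (a i)\<^sup>2) (x \<star> x)"
    using x unfolding diagonal_with_def
    by (auto simp: diagonal_jordan[OF x] power2_eq_square)
  then have 1: "trace_form (x \<star> x) (y \<star> y) =
      (\<Sum>i\<in>UNIV. \<Sum>j\<in>UNIV. (((a i)\<^sup>2 + (a j)\<^sup>2) / 2) * nrm (y $ i $ j)) / real CARD('n)"
    unfolding trace_form_assoc[symmetric]
    using y by (simp add: trace_form_Herm diagonal_jordan re_mult_self)
  have 2: "trace_form (x \<star> y) (y \<star> x) =
      (\<Sum>i\<in>UNIV. \<Sum>j\<in>UNIV. ((a i + a j) / 2)\<^sup>2 * nrm (y $ i $ j)) / real CARD('n)"
    unfolding jordan_commute[of y x]
    using trace_form_self[OF jordan_Herm[OF diagonal_with_Herm[OF x] y]]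
    by (simp add: diagonal_jordan[OF x])
  have 3: "(((a i)\<^sup>2 + (a j)\<^sup>2) / 2) * s - ((a i + a j) / 2)\<^sup>2 * s = ((a i - a j)\<^sup>2 * s) / 4"
    for i j s by (simp add: power2_eq_square field_simps)
  have "trace_form (x \<star> x) (y \<star> y) - trace_form (x \<star> y) (y \<star> x) =
      (\<Sum>i\<in>UNIV. \<Sum>j\<in>UNIV. ((a i - a j)\<^sup>2 * nrm (y $ i $ j)) / 4) / real CARD('n)"
    unfolding 1 2 diff_divide_distrib[symmetric] sum_subtractf[symmetric] 3 ..
  then show ?thesis by (simp flip: sum_divide_distrib)
qed

lemma diagonal_trace_form:
  assumes x: "diagonal_with a (x :: 'a^'n^'n)"
  shows "trace_form x y = (\<Sum>i\<in>UNIV. a i * re (y $ i $ i)) / real CARD('n)"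
proof -
  have "(\<Sum>i\<in>UNIV. \<Sum>j\<in>UNIV. re (x $ i $ j * y $ j $ i)) =
      (\<Sum>i\<in>UNIV. \<Sum>j\<in>UNIV. if i = j then a i * re (y $ i $ i) else 0)"
    using x by (intro sum.cong refl) (simp add: diagonal_with_def)
  then show ?thesis by (simp add: trace_form_def)
qed

lemma diagonal_gram:
  assumes x: "diagonal_with a (x :: 'a^'n^'n)" and y: "y \<in> Herm"
  shows "trace_form x x * trace_form y y - (trace_form x y)\<^sup>2 =
    ((\<Sum>i\<in>UNIV. (a i)\<^sup>2) * (\<Sum>i\<in>UNIV. \<Sum>j\<in>UNIV. nrm (y $ i $ j))
      - (\<Sum>i\<in>UNIV. a i * re (y $ i $ i))\<^sup>2) / (real CARD('n))\<^sup>2"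
proof -
  have "trace_form x x = (\<Sum>i\<in>UNIV. (a i)\<^sup>2) / real CARD('n)"
    using x by (simp add: diagonal_trace_form[OF x] diagonal_with_def power2_eq_square)
  then show ?thesis
    unfolding diagonal_trace_form[OF x, of y] trace_form_self[OF y]
    by (simp add: power2_eq_square diff_divide_distrib)
qed

lemma nrm_diagonal: "y \<in> Herm \<Longrightarrow> nrm ((y :: 'a^'n^'n) $ i $ i) = (re (y $ i $ i))\<^sup>2"
  using Herm_diagonal[of y i] by (metis nrm_scaleR nrm_simps(3) mult_1_right)

lemma diagonal_sectional:
  assumes x: "diagonal_with a (x :: 'a^'n^'n)" and y: "y \<in> Herm"
    and pos: "trace_form x x * trace_form y y - (trace_form x y)\<^sup>2 > 0"
  shows "0 \<le> sectional_nonassoc (\<star>) trace_form x y"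
    and "sectional_nonassoc (\<star>) trace_form x y \<le> real CARD('n) / 2"
    and "sectional_nonassoc (\<star>) trace_form x y = real CARD('n) / 2 \<longleftrightarrow>
      (1 / 2) * (\<Sum>i\<in>UNIV. \<Sum>j\<in>UNIV. (a i - a j)\<^sup>2 * nrm (y $ i $ j)) =
      (\<Sum>i\<in>UNIV. (a i)\<^sup>2) * (\<Sum>i\<in>UNIV. \<Sum>j\<in>UNIV. nrm (y $ i $ j))
        - (\<Sum>i\<in>UNIV. a i * re (y $ i $ i))\<^sup>2"
proof -
  define Q where "Q = (\<Sum>i\<in>UNIV. \<Sum>j\<in>UNIV. (a i - a j)\<^sup>2 * nrm (y $ i $ j))"
  define G where "G = (\<Sum>i\<in>UNIV. (a i)\<^sup>2) * (\<Sum>i\<in>UNIV. \<Sum>j\<in>UNIV. nrm (y $ i $ j))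
        - (\<Sum>i\<in>UNIV. a i * re (y $ i $ i))\<^sup>2"
  have G: "G > 0"
    using pos unfolding diagonal_gram[OF x y] G_def[symmetric] by (simp add: zero_less_divide_iff)
  have K: "sectional_nonassoc (\<star>) trace_form x y = real CARD('n) * Q / (4 * G)"
    unfolding sectional_nonassoc_def diagonal_numerator[OF x y] diagonal_gram[OF x y]
      G_def[symmetric] Q_def[symmetric]
    by (simp add: power2_eq_square)
  have "0 \<le> Q" unfolding Q_def by (intro sum_nonneg) simp
  then show "0 \<le> sectional_nonassoc (\<star>) trace_form x y"
    using G by (simp add: K)
  have "(1 / 2) * Q \<le> G"
    unfolding Q_def G_def by (rule commutator_bound) (simp_all add: nrm_diagonal[OF y])
  then show "sectional_nonassoc (\<star>) trace_form x y \<le> real CARD('n) / 2"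
    using G by (simp add: K field_simps)
  show "sectional_nonassoc (\<star>) trace_form x y = real CARD('n) / 2 \<longleftrightarrow> (1 / 2) * Q = G"
    using G by (auto simp: K field_simps)
qed

text \<open>
  In the equality case every nonzero entry \<open>y i j\<close> with \<open>i \<noteq> j\<close> has \<open>(a i - a j)\<^sup>2 = 2 |a|\<^sup>2\<close>, which
  forces \<open>a j = - a i\<close> and all other \<open>a k = 0\<close>. At most one pair \<open>{i, j}\<close> satisfies this, and there is
  one because otherwise \<open>y\<close> would be a multiple of \<open>x\<close>.
\<close>

lemma diagonal_equality:
  assumes x: "diagonal_with a (x :: 'a^'n^'n)" and y: "y \<in> Herm"
    and pos: "trace_form x x * trace_form y y - (trace_form x y)\<^sup>2 > 0"
    and K: "sectional_nonassoc (\<star>) trace_form x y = real CARD('n) / 2"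
  shows "\<exists>i j \<alpha> c q. i \<noteq> j \<and> q \<noteq> 0 \<and> \<alpha> \<noteq> 0 \<and> x = \<alpha> *\<^sub>R (entry i i 1 - entry j j 1) \<and>
    y = c *\<^sub>R x + herm_entry i j q"
proof -
  let ?S = "\<Sum>i\<in>UNIV. (a i)\<^sup>2" and ?d = "\<lambda>i. re (y $ i $ i)"
  have eq: "(1 / 2) * (\<Sum>i\<in>UNIV. \<Sum>j\<in>UNIV. (a i - a j)\<^sup>2 * nrm (y $ i $ j)) =
      ?S * (\<Sum>i\<in>UNIV. \<Sum>j\<in>UNIV. nrm (y $ i $ j)) - (\<Sum>i\<in>UNIV. a i * ?d i)\<^sup>2"
    using diagonal_sectional(3)[OF x y pos] K by blast
  have S: "?S \<noteq> 0"
  proof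
    assume "?S = 0"
    then have "a i = 0" for i by (simp add: sum_nonneg_eq_0_iff)
    then show False using pos unfolding diagonal_gram[OF x y] by simp
  qed
  note extremal = commutator_bound_equality[where Y = "\<lambda>i j. nrm (y $ i $ j)",
      OF nrm_nonneg nrm_diagonal[OF y] eq S]
  obtain c where c: "\<And>i. ?d i = c * a i" using extremal(2) by blast
  have y_diag: "y $ k $ k = (c * a k) *\<^sub>R 1" for k
    using Herm_diagonal[OF y, of k] c by simp
  have "\<exists>i j. i \<noteq> j \<and> y $ i $ j \<noteq> 0"
  proof (rule ccontr)
    assume "\<not> ?thesis"
    then have "diagonal_with (\<lambda>i. c * a i) y"
      using y_diag by (auto simp: diagonal_with_def)
    then have "y = c *\<^sub>R x"
      using x by (auto simp: vec_eq_iff diagonal_with_def)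
    then show False
      using pos by (simp add: linear_scale[OF linear_trace_form] trace_form_commute[of "c *\<^sub>R x"]
          power2_eq_square)
  qed
  then obtain i j where ij: "i \<noteq> j" "y $ i $ j \<noteq> 0" by blast
  have "(a i - a j)\<^sup>2 = 2 * ?S"
    using extremal(1)[OF ij(1)] ij(2) by simp
  then have "(a i + a j)\<^sup>2 + 2 * (\<Sum>k\<in>UNIV - {i, j}. (a k)\<^sup>2) = 0"
    using off_diagonal_gap[OF ij(1), of a] by linarith
  moreover have "0 \<le> (\<Sum>k\<in>UNIV - {i, j}. (a k)\<^sup>2)" by (simp add: sum_nonneg)
  ultimately have "(a i + a j)\<^sup>2 = 0" "(\<Sum>k\<in>UNIV - {i, j}. (a k)\<^sup>2) = 0"
    using zero_le_power2[of "a i + a j"] by linarith+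
  then have a_j: "a j = - a i" and a_k: "\<And>k. k \<noteq> i \<Longrightarrow> k \<noteq> j \<Longrightarrow> a k = 0"
    by (simp_all add: sum_nonneg_eq_0_iff)
  have a_i: "a i \<noteq> 0"
  proof
    assume "a i = 0"
    then have "a k = 0" for k using a_j a_k by (cases "k = i"; cases "k = j") auto
    then show False using S by simp
  qed
  have S_eq: "?S = 2 * (a i)\<^sup>2"
  proof -
    have "?S = (a i)\<^sup>2 + (a j)\<^sup>2"
      by (rule sum_two_points) (use ij(1) a_k in auto)
    then show ?thesis by (simp add: a_j)
  qed
  have y_off: "y $ k $ l = 0" if "k \<noteq> l" "\<not> (k = i \<and> l = j)" "\<not> (k = j \<and> l = i)" for k l
  proof (rule ccontr)
    assume "y $ k $ l \<noteq> 0"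
    then have "(a k - a l)\<^sup>2 = 4 * (a i)\<^sup>2"
      using extremal(1)[OF that(1)] S_eq by simp
    moreover have "(a k - a l)\<^sup>2 \<le> (a i)\<^sup>2"
      using that a_k a_j by (cases "k = i \<or> k = j"; cases "l = i \<or> l = j") auto
    ultimately show False using a_i zero_less_power2[of "a i"] by linarith
  qed
  have x_eq: "x = a i *\<^sub>R (entry i i 1 - entry j j 1)"
    using x a_j a_k ij(1) by (auto simp: vec_eq_iff diagonal_with_def entry_def)
  have "y = c *\<^sub>R x + herm_entry i j (y $ i $ j)"
  proof -
    have y_ji: "bar (y $ i $ j) = y $ j $ i" using y by (simp add: mem_Herm)
    have x_nth: "x $ k $ l = (if k = l then a k *\<^sub>R 1 else 0)" for k l
      using x by (simp add: diagonal_with_def)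
    have nth: "(c *\<^sub>R x + herm_entry i j (y $ i $ j)) $ k $ l = (if k = l then (c * a k) *\<^sub>R 1
        else if k = i \<and> l = j then y $ i $ j else if k = j \<and> l = i then y $ j $ i else 0)" for k l
      using ij(1) by (auto simp add: x_nth herm_entry_def entry_def y_ji)
    have "y $ k $ l = (c *\<^sub>R x + herm_entry i j (y $ i $ j)) $ k $ l" for k l
      unfolding nth using y_diag y_off by simp
    then show ?thesis unfolding vec_eq_iff by blast
  qed
  then show ?thesis using ij a_i x_eq by blast
qed

text \<open>
  The extremal pair: both estimates behind the upper bound are equalities for it.
\<close>

lemma model_pair:
  fixes p q :: "'n::finite"
  assumes pq: "p \<noteq> q"
  defines "u \<equiv> entry p p 1 - entry q q 1 :: 'a^'n^'n" and "v \<equiv> herm_entry p q 1"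
  shows "u \<in> Herm" "v \<in> Herm" "trace_form u v = 0"
    and "trace_form u u * trace_form v v - (trace_form u v)\<^sup>2 > 0"
    and "sectional_nonassoc (\<star>) trace_form u v = real CARD('n) / 2"
proof -
  define a :: "'n \<Rightarrow> real" where "a k = (if k = p then 1 else if k = q then - 1 else 0)" for k
  have u: "diagonal_with a u"
    using pq by (auto simp: diagonal_with_def a_def u_def entry_def)
  then show "u \<in> Herm" by (rule diagonal_with_Herm)
  show v: "v \<in> Herm" unfolding v_def by (rule herm_entry_Herm)
  have v_nth: "nrm (v $ k $ l) = (if k = p \<and> l = q \<or> k = q \<and> l = p then 1 else 0)" for k l
    using pq by (auto simp: v_def herm_entry_def entry_def)
  have v_diag: "v $ k $ k = 0" for k
    using pq by (auto simp: v_def herm_entry_def entry_def)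
  show uv: "trace_form u v = 0"
    by (simp add: diagonal_trace_form[OF u] v_diag)
  have S: "(\<Sum>k\<in>UNIV. (a k)\<^sup>2) = 2"
    using sum_two_points[of p q "\<lambda>k. (a k)\<^sup>2"] pq by (simp add: a_def)
  have sums: "(\<Sum>k\<in>UNIV. \<Sum>l\<in>UNIV. f k l * nrm (v $ k $ l)) = f p q + f q p" for f
  proof -
    have "(\<Sum>k\<in>UNIV. \<Sum>l\<in>UNIV. f k l * nrm (v $ k $ l)) =
        (\<Sum>l\<in>UNIV. f p l * nrm (v $ p $ l)) + (\<Sum>l\<in>UNIV. f q l * nrm (v $ q $ l))"
      by (rule sum_two_points) (use pq in \<open>auto simp: v_nth\<close>)
    also have "(\<Sum>l\<in>UNIV. f p l * nrm (v $ p $ l)) = (\<Sum>l\<in>UNIV. if l = q then f p l else 0)"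
      by (intro sum.cong) (use pq in \<open>auto simp: v_nth\<close>)
    also have "(\<Sum>l\<in>UNIV. f q l * nrm (v $ q $ l)) = (\<Sum>l\<in>UNIV. if l = p then f q l else 0)"
      by (intro sum.cong) (use pq in \<open>auto simp: v_nth\<close>)
    finally show ?thesis by simp
  qed
  show pos: "trace_form u u * trace_form v v - (trace_form u v)\<^sup>2 > 0"
    unfolding diagonal_gram[OF u v] using S sums[of "\<lambda>k l. 1"]
    by (simp add: v_diag)
  show "sectional_nonassoc (\<star>) trace_form u v = real CARD('n) / 2"
    unfolding diagonal_sectional(3)[OF u v pos] S sums
    using sums[of "\<lambda>k l. 1"] pq by (simp add: a_def v_diag)
qed

text \<open>
  An automorphism makes \<open>x\<close> diagonal and preserves all quantities involved. In the extremal case a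
  permutation moves the two distinguished indices to \<open>p, q\<close>, and a phase makes the entry there real.
\<close>

lemma sectional_bounds:
  assumes dich: "(\<forall>a b c::'a. (a * b) * c = a * (b * c)) \<or> CARD('n) = 3"
    and x: "(x :: 'a^'n^'n) \<in> Herm" and y: "y \<in> Herm" and xy: "x \<noteq> y" "independent {x, y}"
  shows "0 \<le> sectional_nonassoc (\<star>) trace_form x y"
    and "sectional_nonassoc (\<star>) trace_form x y \<le> real CARD('n) / 2"
    and "\<lbrakk>sectional_nonassoc (\<star>) trace_form x y = real CARD('n) / 2; p \<noteq> q\<rbrakk> \<Longrightarrow>
      \<exists>\<phi>\<in>alg_aut Herm (\<star>). \<exists>\<alpha> c r. \<alpha> \<noteq> 0 \<and> r \<noteq> 0 \<and> \<phi> x = \<alpha> *\<^sub>R (entry p p 1 - entry q q 1) \<and>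
        \<phi> y = c *\<^sub>R (entry p p 1 - entry q q 1) + r *\<^sub>R herm_entry p q 1"
proof -
  interpret metric_algebra "Herm :: ('a^'n^'n) set" "(\<star>)" trace_form
    by (rule metric_algebra_Herm)
  obtain \<phi> where \<phi>: "\<phi> \<in> alg_aut Herm (\<star>)" "\<And>i j. i \<noteq> j \<Longrightarrow> \<phi> x $ i $ j = 0"
    using diagonalise[OF dich x] by blast
  define a where "a i = re (\<phi> x $ i $ i)" for i
  have \<phi>x: "diagonal_with a (\<phi> x)"
    using \<phi>(2) Herm_diagonal[OF alg_autD(3)[OF \<phi>(1) x]] by (simp add: diagonal_with_def a_def)
  have \<phi>y: "\<phi> y \<in> Herm" using alg_autD(3)[OF \<phi>(1) y] .
  have pos: "gram (\<phi> x) (\<phi> y) > 0"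
    using gram_pos[OF x y xy] sectional_nonassoc_aut(2)[OF \<phi>(1) x y] by simp
  note K = sectional_nonassoc_aut(1)[OF \<phi>(1) x y]
  show "0 \<le> sectional_nonassoc (\<star>) trace_form x y"
    "sectional_nonassoc (\<star>) trace_form x y \<le> real CARD('n) / 2"
    using diagonal_sectional(1,2)[OF \<phi>x \<phi>y pos] unfolding K by auto
  assume max: "sectional_nonassoc (\<star>) trace_form x y = real CARD('n) / 2" and pq: "p \<noteq> q"
  obtain i j \<alpha> c s where ij: "i \<noteq> j" "s \<noteq> 0" "\<alpha> \<noteq> 0"
    and eqs: "\<phi> x = \<alpha> *\<^sub>R (entry i i 1 - entry j j 1)" "\<phi> y = c *\<^sub>R \<phi> x + herm_entry i j s"
    using diagonal_equality[OF \<phi>x \<phi>y pos] max unfolding K by blast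
  obtain \<pi> :: "'n \<Rightarrow> 'n" where \<pi>: "bij \<pi>" "\<pi> p = i" "\<pi> q = j"
  proof
    \<comment> \<open>First exchange i and p; then move q to the place from which this exchange reaches j.\<close>
    let ?j = "Transposition.transpose i p j"
    let ?\<pi> = "Transposition.transpose i p \<circ> Transposition.transpose q ?j"
    have "?j \<noteq> p" using ij(1) by (auto simp: Transposition.transpose_def)
    then show "?\<pi> p = i" "?\<pi> q = j"
      using pq by (simp_all add: Transposition.transpose_apply_other)
    show "bij ?\<pi>" by (intro bij_comp) simp_all
  qed
  have \<pi>_iff: "\<pi> k = \<pi> l \<longleftrightarrow> k = l" for k l
    using \<pi>(1) by (simp add: bij_def inj_eq)
  have entry_\<pi>: "reindex \<pi> (entry (\<pi> k) (\<pi> l) b) = entry k l b" for k l and b :: 'a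
    by (simp add: vec_eq_iff entry_def \<pi>_iff)
  have lin: "linear (reindex \<pi> :: 'a^'n^'n \<Rightarrow> 'a^'n^'n)"
    by (rule linearI) (simp_all add: vec_eq_iff)
  have \<pi>_u: "reindex \<pi> (entry i i 1 - entry j j 1 :: 'a^'n^'n) = entry p p 1 - entry q q 1"
    unfolding linear_diff[OF lin] \<pi>(2,3)[symmetric] entry_\<pi> ..
  have \<pi>_v: "reindex \<pi> (herm_entry i j s) = herm_entry p q s"
    unfolding herm_entry_def linear_add[OF lin] \<pi>(2,3)[symmetric] entry_\<pi> ..
  obtain d where d: "diag_conj d \<in> alg_aut (Herm :: ('a^'n^'n) set) (\<star>)" "\<And>r. nrm (d r) = 1"
    "d p * (s * bar (d q)) = sqrt (nrm s) *\<^sub>R 1"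
    using phase_aut[OF dich pq ij(2)] by blast
  have d_u: "diag_conj d (entry p p 1 - entry q q 1 :: 'a^'n^'n) = entry p p 1 - entry q q 1"
    using d(2) by (simp add: vec_eq_iff entry_def mult_bar_self)
  have d_v: "diag_conj d (herm_entry p q s) = sqrt (nrm s) *\<^sub>R herm_entry p q 1"
  proof -
    have "bar (diag_conj d (herm_entry p q s) $ p $ q) = diag_conj d (herm_entry p q s) $ q $ p"
      using alg_autD(3)[OF d(1) herm_entry_Herm] by (simp add: mem_Herm del: diag_conj_nth)
    then have "d q * (bar s * bar (d p)) = sqrt (nrm s) *\<^sub>R 1"
      using d(3) pq by (simp add: herm_entry_def entry_def del: bar_mult)
    then show ?thesis
      using d(3) pq by (simp add: vec_eq_iff herm_entry_def entry_def)
  qed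
  let ?\<psi> = "\<lambda>x. diag_conj d (reindex \<pi> (\<phi> x))"
  show "\<exists>\<phi>\<in>alg_aut Herm (\<star>). \<exists>\<alpha> c r. \<alpha> \<noteq> 0 \<and> r \<noteq> 0 \<and> \<phi> x = \<alpha> *\<^sub>R (entry p p 1 - entry q q 1) \<and>
      \<phi> y = c *\<^sub>R (entry p p 1 - entry q q 1) + r *\<^sub>R herm_entry p q 1"
  proof (intro bexI exI conjI)
    show "?\<psi> \<in> alg_aut Herm (\<star>)"
      by (intro alg_aut_compose[OF alg_aut_compose[OF \<phi>(1) reindex_aut[OF \<pi>(1)]] d(1)])
    show "?\<psi> x = \<alpha> *\<^sub>R (entry p p 1 - entry q q 1)"
      unfolding eqs(1) linear_scale[OF lin] linear_scale[OF linear_diag_conj] \<pi>_u d_u ..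
    show "?\<psi> y = (c * \<alpha>) *\<^sub>R (entry p p 1 - entry q q 1) + sqrt (nrm s) *\<^sub>R herm_entry p q 1"
      unfolding eqs linear_add[OF lin] linear_add[OF linear_diag_conj] linear_scale[OF lin]
        linear_scale[OF linear_diag_conj] \<pi>_u d_u \<pi>_v d_v scaleR_scaleR ..
    show "sqrt (nrm s) \<noteq> 0" using ij(2) by simp
  qed (rule ij(3))
qed

lemma trace_form_mat_prod: "trace_form (mat_prod x y) (z :: 'a^'n^'n) = trace_form x (mat_prod y z)"
proof -
  have "(\<Sum>i\<in>UNIV. \<Sum>j\<in>UNIV. re ((\<Sum>k\<in>UNIV. x $ i $ k * y $ k $ j) * z $ j $ i)) =
      (\<Sum>i\<in>UNIV. \<Sum>j\<in>UNIV. \<Sum>k\<in>UNIV. re (x $ i $ k * (y $ k $ j * z $ j $ i)))"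
    by (simp add: star_sum_left re_sum re_mult_assoc)
  also have "\<dots> = (\<Sum>i\<in>UNIV. \<Sum>k\<in>UNIV. \<Sum>j\<in>UNIV. re (x $ i $ k * (y $ k $ j * z $ j $ i)))"
    by (intro sum.cong refl sum.swap)
  finally show ?thesis
    by (simp add: trace_form_def mat_prod_nth star_sum_right re_sum)
qed

context
  assumes assoc: "\<And>a b c :: 'a. (a * b) * c = a * (b * c)"
begin

lemma mat_prod_assoc: "mat_prod (mat_prod x y) z = mat_prod x (mat_prod y (z :: 'a^'n^'n))"
proof -
  have "(\<Sum>k\<in>UNIV. (\<Sum>l\<in>UNIV. x $ i $ l * y $ l $ k) * z $ k $ j) =
      (\<Sum>l\<in>UNIV. x $ i $ l * (\<Sum>k\<in>UNIV. y $ l $ k * z $ k $ j))" for i j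
    unfolding star_sum_left star_sum_right assoc by (rule sum.swap)
  then show ?thesis by (simp add: vec_eq_iff mat_prod_nth)
qed

text \<open>
  The commutator of Hermitian matrices is skew-Hermitian, so its squared norm is minus the
  trace of its square; expanding and using cyclicity of the trace leaves a multiple of the numerator of the
  sectional nonassociativity.
\<close>

lemma commutator_norm:
  fixes x y :: "'a^'n^'n"
  assumes xy: "x \<in> Herm" "y \<in> Herm"
  shows "4 * real CARD('n) * (trace_form (x \<star> x) (y \<star> y) - trace_form (x \<star> y) (y \<star> x)) =
    (\<Sum>i\<in>UNIV. \<Sum>j\<in>UNIV. nrm ((mat_prod x y - mat_prod y x) $ i $ j))"
proof -
  let ?p = "mat_prod x y" and ?q = "mat_prod y x" and ?n = "real CARD('n)"
  note lin = linear_add[OF linear_trace_form] linear_diff[OF linear_trace_form]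
    linear_scale[OF linear_trace_form]
  have lin': "trace_form (a + b) c = trace_form a c + trace_form b c"
    "trace_form (a - b) c = trace_form a c - trace_form b c"
    "trace_form (r *\<^sub>R a) c = r * trace_form a c" for a b c :: "'a^'n^'n" and r
    by (simp_all add: trace_form_commute[of _ c] lin)
  have "bar (?p $ j $ i) = ?q $ i $ j" "bar (?q $ j $ i) = ?p $ i $ j" for i j
    using xy by (simp_all add: mat_prod_nth bar_sum mem_Herm)
  then have bar: "bar ((?p - ?q) $ j $ i) = - (?p - ?q) $ i $ j" for i j by simp
  have "(\<Sum>i\<in>UNIV. \<Sum>j\<in>UNIV. nrm ((?p - ?q) $ i $ j)) =
      (\<Sum>i\<in>UNIV. \<Sum>j\<in>UNIV. - re ((?p - ?q) $ i $ j * (?p - ?q) $ j $ i))"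
    unfolding re_mult_self[symmetric] bar by simp
  also have "\<dots> = - ?n * trace_form (?p - ?q) (?p - ?q)"
    unfolding trace_form_def sum_negf by simp
  also have "\<dots> = - ?n * (trace_form ?p ?p - 2 * trace_form ?p ?q + trace_form ?q ?q)"
    by (simp add: lin lin' trace_form_commute[of ?q ?p])
  finally have norm: "(\<Sum>i\<in>UNIV. \<Sum>j\<in>UNIV. nrm ((?p - ?q) $ i $ j)) = \<dots>" .
  have pq: "trace_form ?p ?q = trace_form (mat_prod x x) (mat_prod y y)"
  proof -
    have "trace_form ?p ?q = trace_form x (mat_prod (mat_prod y y) x)"
      by (simp add: trace_form_mat_prod mat_prod_assoc)
    also have "\<dots> = trace_form (mat_prod y y) (mat_prod x x)"
      by (simp add: trace_form_commute[of x] trace_form_mat_prod)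
    finally show ?thesis by (simp add: trace_form_commute)
  qed
  have qq: "trace_form ?q ?q = trace_form ?p ?p"
  proof -
    have "trace_form ?q ?q = trace_form y (mat_prod ?p x)"
      by (simp add: trace_form_mat_prod mat_prod_assoc)
    also have "\<dots> = trace_form ?p ?p"
      by (simp add: trace_form_commute[of y] trace_form_mat_prod)
    finally show ?thesis .
  qed
  have sq: "z \<star> z = mat_prod z z" for z :: "'a^'n^'n"
    by (simp add: jordan_def flip: scaleR_2)
  have "trace_form (x \<star> y) (y \<star> x) = (1 / 4) * (trace_form ?p ?p + 2 * trace_form ?p ?q + trace_form ?q ?q)"
    by (simp add: jordan_def lin lin' trace_form_commute[of ?q ?p])
  then have xy_yx: "trace_form (x \<star> y) (y \<star> x) = (1 / 2) * (trace_form ?p ?p + trace_form ?p ?q)"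
    unfolding qq by simp
  show ?thesis
    unfolding norm sq pq[symmetric] qq xy_yx by algebra
qed

lemma sectional_eq_0_iff:
  fixes x y :: "'a^'n^'n"
  assumes xy: "x \<in> Herm" "y \<in> Herm"
    and gram: "trace_form x x * trace_form y y - (trace_form x y)\<^sup>2 \<noteq> 0"
  shows "sectional_nonassoc (\<star>) trace_form x y = 0 \<longleftrightarrow> mat_prod x y = mat_prod y x"
proof -
  have "sectional_nonassoc (\<star>) trace_form x y = 0 \<longleftrightarrow>
      4 * real CARD('n) * (trace_form (x \<star> x) (y \<star> y) - trace_form (x \<star> y) (y \<star> x)) = 0"
    using gram by (simp add: sectional_nonassoc_def)
  also have "\<dots> \<longleftrightarrow> mat_prod x y - mat_prod y x = 0"
    unfolding commutator_norm[OF xy]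
    by (simp add: sum_nonneg_eq_0_iff sum_nonneg vec_eq_iff)
  finally show ?thesis by simp
qed

lemma mat_prod_square_commute: "mat_prod x (x \<star> x) = mat_prod (x \<star> x) (x :: 'a^'n^'n)"
  by (simp add: jordan_def mat_prod_assoc flip: scaleR_2)

end

end

lemma hurwitz_algebra_cases:
  assumes "star_isomorphic TYPE('a) TYPE(real) \<or> star_isomorphic TYPE('a) TYPE(complex) \<or>
           star_isomorphic TYPE('a) TYPE(quat) \<or> star_isomorphic TYPE('a::star_algebra) TYPE(octo)"
  shows "hurwitz TYPE('a)"
    and "(\<forall>a b c::'a. (a * b) * c = a * (b * c)) \<or> star_isomorphic TYPE('a) TYPE(octo)"
  using assms hurwitz_star_isomorphic[OF _ hurwitz_real] hurwitz_star_isomorphic[OF _ hurwitz_complex]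
    hurwitz_star_isomorphic[OF _ hurwitz_quat] hurwitz_star_isomorphic[OF _ hurwitz_octo]
    assoc_star_isomorphic[where ?'a = 'a and ?'b = real, OF _ mult.assoc]
    assoc_star_isomorphic[where ?'a = 'a and ?'b = complex, OF _ mult.assoc]
    assoc_star_isomorphic[where ?'a = 'a and ?'b = quat, OF _ quat_assoc]
  by blast+

theorem theorem6p3:
  fixes n :: nat and \<iota> :: "nat \<Rightarrow> 'n::finite"
    and u v :: "'a::star_algebra^'n^'n"
  assumes "star_isomorphic TYPE('a) TYPE(real) \<or> star_isomorphic TYPE('a) TYPE(complex) \<or>
           star_isomorphic TYPE('a) TYPE(quat) \<or> star_isomorphic TYPE('a) TYPE(octo)"
    and "n \<ge> 2"
    and "star_isomorphic TYPE('a) TYPE(octo) \<Longrightarrow> n = 3"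
    \<comment> \<open>\<open>\<iota>\<close> labels the rows and columns by \<open>1, \<dots>, n\<close>; in particular \<open>CARD('n) = n\<close>\<close>
    and "bij_betw \<iota> {1..n} UNIV"
    and "u = mat_unit (\<iota> 1) (\<iota> 1) - mat_unit (\<iota> n) (\<iota> n)"
    and "v = mat_unit (\<iota> 1) (\<iota> n) + mat_unit (\<iota> n) (\<iota> 1)"
  shows
    "invariant_metric (Herm :: ('a^'n^'n) set) (\<star>) herm_metric \<and>
     (\<forall>x\<in>Herm. \<forall>y\<in>(Herm :: ('a^'n^'n) set).
        herm_metric x y *\<^sub>R 1 = (1 / real n) *\<^sub>R mat_trace (x \<star> y)) \<and>
     (\<forall>x\<in>Herm. \<forall>y\<in>(Herm :: ('a^'n^'n) set). x \<noteq> y \<and> independent {x, y} \<longrightarrow>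
        herm_metric x x * herm_metric y y - (herm_metric x y)\<^sup>2 \<noteq> 0 \<and>
        0 \<le> herm_K x y \<and> herm_K x y \<le> real n / 2 \<and>
        ((\<forall>a b c :: 'a. (a * b) * c = a * (b * c)) \<longrightarrow>
          (herm_K x y = 0 \<longleftrightarrow> mat_prod x y = mat_prod y x)) \<and>
        (herm_K x y = real n / 2 \<longleftrightarrow>
          (\<exists>\<phi>\<in>alg_aut Herm (\<star>). \<phi> ` span {x, y} = span {u, v})) \<and>
        (herm_K x y = real n / 2 \<and> herm_metric x y = 0 \<longleftrightarrow>
          (\<exists>\<phi>\<in>alg_aut Herm (\<star>). \<exists>a b :: real. \<phi> x = a *\<^sub>R u \<and> \<phi> y = b *\<^sub>R v))) \<and>
     ((\<forall>a b c :: 'a. (a * b) * c = a * (b * c)) \<longrightarrow>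
        (\<forall>x\<in>(Herm :: ('a^'n^'n) set). x \<noteq> x \<star> x \<and> independent {x, x \<star> x} \<longrightarrow>
          herm_K x (x \<star> x) = 0))"
proof -
  interpret hurwitz "TYPE('a)" by (rule hurwitz_algebra_cases(1)[OF assms(1)])
  interpret metric_algebra "Herm :: ('a^'n^'n) set" "(\<star>)" trace_form
    by (rule metric_algebra_Herm)
  have n: "n = CARD('n)"
    using bij_betw_same_card[OF assms(4)] by simp
  have dich: "(\<forall>a b c::'a. (a * b) * c = a * (b * c)) \<or> CARD('n) = 3"
    using hurwitz_algebra_cases(2)[OF assms(1)] assms(3) unfolding n by blast
  have pq: "\<iota> 1 \<noteq> \<iota> n"
    using assms(2) bij_betw_imp_inj_on[OF assms(4)] by (auto dest: inj_onD)
  have u: "u = entry (\<iota> 1) (\<iota> 1) 1 - entry (\<iota> n) (\<iota> n) 1"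
    and v: "v = herm_entry (\<iota> 1) (\<iota> n) 1"
    by (simp_all add: assms(5,6) mat_unit_eq herm_entry_def)
  note model = model_pair[OF pq, folded u v]
  let ?K = "sectional_nonassoc (\<star>) trace_form :: 'a^'n^'n \<Rightarrow> 'a^'n^'n \<Rightarrow> real"
  have K: "herm_K x y = ?K x y" if "x \<in> Herm" "y \<in> Herm" for x y :: "'a^'n^'n"
    using that by (simp add: sectional_nonassoc_def herm_metric_eq_trace_form jordan_Herm)
  have invariant: "invariant_metric (Herm :: ('a^'n^'n) set) (\<star>) herm_metric"
    unfolding invariant_metric_def
  proof (intro conjI ballI impI)
    fix x :: "'a^'n^'n" assume x: "x \<in> Herm"
    show "lin_on Herm (herm_metric x)" "lin_on Herm (\<lambda>y. herm_metric y x)"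
      using x V by (simp_all add: lin_on_def herm_metric_eq_trace_form subspace_add subspace_scale h_simps)
    show "x = 0" if "\<forall>y\<in>Herm. herm_metric x y = 0"
      using that x h_pos[OF x] by (auto simp: herm_metric_eq_trace_form)
    fix y :: "'a^'n^'n" assume y: "y \<in> Herm"
    show "herm_metric x y = herm_metric y x"
      using x y by (simp add: herm_metric_eq_trace_form trace_form_commute)
    fix z :: "'a^'n^'n" assume z: "z \<in> Herm"
    show "herm_metric (x \<star> y) z = herm_metric x (y \<star> z)"
      using x y z by (simp add: herm_metric_eq_trace_form jordan_Herm trace_form_assoc)
  qed
  have trace: "herm_metric x y *\<^sub>R 1 = (1 / real n) *\<^sub>R mat_trace (x \<star> y)"
    if "x \<in> Herm" "y \<in> Herm" for x y :: "'a^'n^'n"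
    using mat_trace_jordan[OF that] that by (simp add: herm_metric_eq_trace_form n)
  have plane:
    "herm_metric x x * herm_metric y y - (herm_metric x y)\<^sup>2 \<noteq> 0 \<and>
        0 \<le> herm_K x y \<and> herm_K x y \<le> real n / 2 \<and>
        ((\<forall>a b c :: 'a. (a * b) * c = a * (b * c)) \<longrightarrow>
          (herm_K x y = 0 \<longleftrightarrow> mat_prod x y = mat_prod y x)) \<and>
        (herm_K x y = real n / 2 \<longleftrightarrow>
          (\<exists>\<phi>\<in>alg_aut Herm (\<star>). \<phi> ` span {x, y} = span {u, v})) \<and>
        (herm_K x y = real n / 2 \<and> herm_metric x y = 0 \<longleftrightarrow>
          (\<exists>\<phi>\<in>alg_aut Herm (\<star>). \<exists>a b :: real. \<phi> x = a *\<^sub>R u \<and> \<phi> y = b *\<^sub>R v))"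
    if x: "x \<in> Herm" and y: "y \<in> Herm" and xy: "x \<noteq> y \<and> independent {x, y}" for x y :: "'a^'n^'n"
  proof -
    note xy = conjunct1[OF xy] conjunct2[OF xy]
    note pos = gram_pos[OF x y xy]
    note bounds = sectional_bounds[OF dich x y xy]
    have max_if: "?K x y = real n / 2"
      if \<phi>: "\<phi> \<in> alg_aut Herm (\<star>)" and eq: "\<phi> x = \<alpha> *\<^sub>R u + \<beta> *\<^sub>R v" "\<phi> y = \<gamma> *\<^sub>R u + \<delta> *\<^sub>R v"
      for \<phi> \<alpha> \<beta> \<gamma> \<delta>
    proof -
      have "0 < (\<alpha> * \<delta> - \<beta> * \<gamma>)\<^sup>2 * gram u v"
        using pos sectional_nonassoc_aut(2)[OF \<phi> x y] unfolding eq gram_change_of_basis by simp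
      then have "\<alpha> * \<delta> - \<beta> * \<gamma> \<noteq> 0" by auto
      from sectional_nonassoc_change_of_basis[OF jordan_commute this, of u v]
      show ?thesis
        using sectional_nonassoc_aut(1)[OF \<phi> x y] model(5) n unfolding eq by simp
    qed
    have span: "?K x y = real n / 2 \<longleftrightarrow> (\<exists>\<phi>\<in>alg_aut Herm (\<star>). \<phi> ` span {x, y} = span {u, v})"
    proof
      assume "?K x y = real n / 2"
      then obtain \<phi> \<alpha> c r where \<phi>: "\<phi> \<in> alg_aut Herm (\<star>)" "\<alpha> \<noteq> 0" "r \<noteq> 0"
        "\<phi> x = \<alpha> *\<^sub>R u" "\<phi> y = c *\<^sub>R u + r *\<^sub>R v"
        using bounds(3)[OF _ pq] n unfolding u v by metis
      have uv: "u = (1 / \<alpha>) *\<^sub>R \<phi> x" "v = (- c / (\<alpha> * r)) *\<^sub>R \<phi> x + (1 / r) *\<^sub>R \<phi> y"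
        using \<phi>(2,3) by (simp_all add: \<phi>(4,5) scaleR_add_right)
      have "span {\<phi> x, \<phi> y} = span {u, v}"
        unfolding span_eq
      proof
        show "{\<phi> x, \<phi> y} \<subseteq> span {u, v}"
          unfolding \<phi>(4,5) by (auto intro!: span_add span_scale intro: span_base)
        have "(1 / \<alpha>) *\<^sub>R \<phi> x \<in> span {\<phi> x, \<phi> y}"
          "(- c / (\<alpha> * r)) *\<^sub>R \<phi> x + (1 / r) *\<^sub>R \<phi> y \<in> span {\<phi> x, \<phi> y}"
          by (intro span_add span_scale span_base; simp)+
        then show "{u, v} \<subseteq> span {\<phi> x, \<phi> y}"
          unfolding uv[symmetric] by simp
      qed
      then show "\<exists>\<phi>\<in>alg_aut Herm (\<star>). \<phi> ` span {x, y} = span {u, v}"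
        using \<phi>(1) alg_aut_span_pair[OF V \<phi>(1) x y] by auto
    next
      assume "\<exists>\<phi>\<in>alg_aut Herm (\<star>). \<phi> ` span {x, y} = span {u, v}"
      then obtain \<phi> where \<phi>: "\<phi> \<in> alg_aut Herm (\<star>)" "\<phi> ` span {x, y} = span {u, v}" by blast
      then have "\<phi> x \<in> span {u, v}" "\<phi> y \<in> span {u, v}"
        by (auto intro: span_base)
      then show "?K x y = real n / 2"
        using max_if[OF \<phi>(1)] unfolding span_pair[of u v] by auto
    qed
    have vectors: "?K x y = real n / 2 \<and> trace_form x y = 0 \<longleftrightarrow>
      (\<exists>\<phi>\<in>alg_aut Herm (\<star>). \<exists>a b :: real. \<phi> x = a *\<^sub>R u \<and> \<phi> y = b *\<^sub>R v)"
    proof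
      assume K: "?K x y = real n / 2 \<and> trace_form x y = 0"
      then obtain \<phi> \<alpha> c r where \<phi>: "\<phi> \<in> alg_aut Herm (\<star>)" "\<alpha> \<noteq> 0" "r \<noteq> 0"
        "\<phi> x = \<alpha> *\<^sub>R u" "\<phi> y = c *\<^sub>R u + r *\<^sub>R v"
        using bounds(3)[OF _ pq] n unfolding u v by metis
      have "trace_form (\<phi> x) (\<phi> y) = 0"
        using aut_isometry[OF \<phi>(1) x y] K by simp
      then have "\<alpha> * c * trace_form u u = 0"
        by (auto simp: \<phi>(4,5) h_simps model(3))
      moreover have "trace_form u u \<noteq> 0"
        using model(3,4) by auto
      ultimately have "c = 0" using \<phi>(2) by simp
      then show "\<exists>\<phi>\<in>alg_aut Herm (\<star>). \<exists>a b :: real. \<phi> x = a *\<^sub>R u \<and> \<phi> y = b *\<^sub>R v"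
        using \<phi> by (auto intro!: bexI[of _ \<phi>])
    next
      assume "\<exists>\<phi>\<in>alg_aut Herm (\<star>). \<exists>a b :: real. \<phi> x = a *\<^sub>R u \<and> \<phi> y = b *\<^sub>R v"
      then obtain \<phi> a b where \<phi>: "\<phi> \<in> alg_aut Herm (\<star>)" "\<phi> x = a *\<^sub>R u" "\<phi> y = b *\<^sub>R v"
        by blast
      have "?K x y = real n / 2"
        by (rule max_if[OF \<phi>(1), of a 0 0 b]) (simp_all add: \<phi>(2,3))
      moreover have "trace_form x y = 0"
        using aut_isometry[OF \<phi>(1) x y] by (simp add: \<phi>(2,3) h_simps model(3))
      ultimately show "?K x y = real n / 2 \<and> trace_form x y = 0" by blast
    qed
    have zero: "?K x y = 0 \<longleftrightarrow> mat_prod x y = mat_prod y x"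
      if "\<forall>a b c :: 'a. (a * b) * c = a * (b * c)"
      using sectional_eq_0_iff[OF _ x y] that pos by simp
    show ?thesis
      unfolding K[OF x y] herm_metric_eq_trace_form[OF x y] herm_metric_eq_trace_form[OF x x]
        herm_metric_eq_trace_form[OF y y]
      using pos bounds(1,2) zero span vectors n by (intro conjI impI) simp_all
  qed
  have square: "herm_K x (x \<star> x) = 0"
    if assoc: "\<forall>a b c :: 'a. (a * b) * c = a * (b * c)"
      and x: "x \<in> Herm" and indep: "x \<noteq> x \<star> x \<and> independent {x, x \<star> x}" for x :: "'a^'n^'n"
  proof -
    have xx: "x \<star> x \<in> Herm" using x x by (rule jordan_Herm)
    then have "?K x (x \<star> x) = 0"
      using sectional_eq_0_iff[OF _ x xx] mat_prod_square_commute[of x] assoc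
        gram_pos[OF x xx conjunct1[OF indep] conjunct2[OF indep]] by simp
    then show ?thesis using K[OF x xx] by simp
  qed
  show ?thesis
    by (rule conjI[OF invariant conjI[OF _ conjI]];
        intro ballI impI; rule trace plane square; assumption)
qed

end
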